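(* Let $H$ be a time-independent, hermitian, number-parity-preserving Hamiltonian on $h$. Define $$e^{i\mathcal S}:=e^{i\epsilon\mathcal P}\prod_{t=0}^{N-1}e^{-i\epsilon H_t},\qquad \mathcal V:=\prod_{t=0}^{N-1}e^{i\epsilon tH_t}.$$ Then $$e^{i\mathcal S}=e^{-iTH_0}\,\mathcal V^\dagger e^{i\epsilon\mathcal P}\mathcal V.$$
   Context: Fix integers $L\ge1$, $N\ge1$, a real $\epsilon>0$, and set $T=\epsilon N$. The space $h$. Let $h$ be the fermionic Fock space of $L$ modes with ladder operators $a_i$ satisfying $\{a_i,a_j^\dagger\}=\delta_{ij}$ and $\{a_i,a_j\}=\{a_i^\dagger,a_j^\dagger\}=0$. The space $\mathcal H$. Let $\mathcal H$ be the Fock space generated from a vacuum $|\Omega\rangle$ by $a_{ti}$, $t=0,\dots,N-1$, $i=1,\dots,L$, with $\{a_{ti},a^\dagger_{t'j}\}=\delta_{tt'}\delta_{ij}$ and all other anticommutators zero. Time translations. Set $\omega_n=(2n+1)\pi/T$ and $\hat a_{ni}=N^{-1/2}\sum_te^{i\omega_n\epsilon t}a_{ti}$. Define $$\mathcal P=\sum_{n,j}\omega_n\hat a^\dagger_{nj}\hat a_{nj}.$$ Parity-preserving Hamiltonians on slices. A Hamiltonian $H$ is parity preserving if it is an even polynomial in the ladder operators, i.e. each monomial has an even number of factors. $H_t$ denotes $H$ placed on slice $t$: its image under the unital $*$-homomorphism determined by $a_i\mapsto a_{ti}$. In particular, $H_0$ is $H$ acting on slice $0$. *)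

theory Defs
  imports Complex_Main "Jordan_Normal_Form.Matrix"
begin

(* Fermionic Fock space of M modes (modes 0..M-1), dimension 2^M.
   Basis vector with index b < 2^M has mode m occupied iff bit b m.
   Jordan-Wigner convention: a_m |b> = (-1)^(#occupied modes < m) |b - 2^m>. *)

definition fock_dim :: "nat \<Rightarrow> nat" where
  "fock_dim M = 2 ^ M"

definition dagger :: "complex mat \<Rightarrow> complex mat" where
  "dagger A = mat (dim_col A) (dim_row A) (\<lambda>(i,j). cnj (A $$ (j,i)))"

definition ann :: "nat \<Rightarrow> nat \<Rightarrow> complex mat" where
  "ann M m = mat (fock_dim M) (fock_dim M)
     (\<lambda>(c,b). if bit b m \<and> c = b - 2 ^ m
              then (-1) ^ card {k. k < m \<and> bit b k} else 0)"

definition ladder :: "nat \<Rightarrow> nat \<Rightarrow> bool \<Rightarrow> complex mat" where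
  "ladder M m d = (if d then dagger (ann M m) else ann M m)"

definition mexp :: "complex mat \<Rightarrow> complex mat" where
  "mexp A = mat (dim_row A) (dim_col A)
     (\<lambda>(i,j). \<Sum>k. (A ^\<^sub>m k) $$ (i,j) / of_nat (fact k))"

definition oprod :: "nat \<Rightarrow> nat \<Rightarrow> (nat \<Rightarrow> complex mat) \<Rightarrow> complex mat" where
  "oprod D n F = foldr (*) (map F [0..<n]) (1\<^sub>m D)"

(* Noncommutative polynomial in ladder operators of L modes:
   list of monomials (coefficient, word of ladder letters (mode, is_creation)). *)
type_synonym ladder_poly = "(complex \<times> (nat \<times> bool) list) list"

definition eval_poly :: "nat \<Rightarrow> (nat \<Rightarrow> bool \<Rightarrow> complex mat) \<Rightarrow> ladder_poly \<Rightarrow> complex mat" where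
  "eval_poly D lad p =
     foldr (+) (map (\<lambda>(c, w). c \<cdot>\<^sub>m foldr (*) (map (\<lambda>(i, d). lad i d) w) (1\<^sub>m D)) p)
       (0\<^sub>m D D)"

definition ham_h :: "nat \<Rightarrow> ladder_poly \<Rightarrow> complex mat" where
  "ham_h L p = eval_poly (fock_dim L) (\<lambda>i d. ladder L i d) p"

(* H_t on the big space (N*L modes, mode (t,i) encoded as t*L+i) *)
definition ham_slice :: "nat \<Rightarrow> nat \<Rightarrow> ladder_poly \<Rightarrow> nat \<Rightarrow> complex mat" where
  "ham_slice N L p t = eval_poly (fock_dim (N*L)) (\<lambda>i d. ladder (N*L) (t*L+i) d) p"

definition valid_ham :: "nat \<Rightarrow> ladder_poly \<Rightarrow> bool" where
  "valid_ham L p \<longleftrightarrow>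
     (\<forall>(c, w) \<in> set p. even (length w) \<and> (\<forall>(i, d) \<in> set w. i < L))
     \<and> dagger (ham_h L p) = ham_h L p"

definition omega :: "nat \<Rightarrow> real \<Rightarrow> nat \<Rightarrow> real" where
  "omega N eps n = (2 * real n + 1) * pi / (eps * real N)"

definition ahat :: "nat \<Rightarrow> nat \<Rightarrow> real \<Rightarrow> nat \<Rightarrow> nat \<Rightarrow> complex mat" where
  "ahat N L eps n j =
     foldr (+) (map (\<lambda>t. (exp (\<i> * complex_of_real (omega N eps n * eps * real t))
                           / complex_of_real (sqrt (real N))) \<cdot>\<^sub>m ann (N*L) (t*L+j)) [0..<N])
       (0\<^sub>m (fock_dim (N*L)) (fock_dim (N*L)))"

definition Pop :: "nat \<Rightarrow> nat \<Rightarrow> real \<Rightarrow> complex mat" where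
  "Pop N L eps =
     foldr (+) (map (\<lambda>(n, j). complex_of_real (omega N eps n) \<cdot>\<^sub>m
                        (dagger (ahat N L eps n j) * ahat N L eps n j))
                 (List.product [0..<N] [0..<L]))
       (0\<^sub>m (fock_dim (N*L)) (fock_dim (N*L)))"

end

theory Submission
  imports Defs
begin

text \<open>
  Write \<open>U\<close> for the exponential of \<open>\<i> eps P\<close>. The \<open>n\<close>-th Fourier mode lowers \<open>P\<close> by \<open>\<omega>\<^sub>n\<close>, so
  conjugation by \<open>U\<close> multiplies it by a phase, which in the time picture reads
  \<open>U a\<^sub>t = a\<^sub>t\<^sub>+\<^sub>1 U\<close> with \<open>a\<^sub>N = - a\<^sub>0\<close>. The sign disappears on even polynomials, so \<open>U\<close> permutes
  the slice Hamiltonians \<open>H\<^sub>t\<close> cyclically. These commute with each other, so moving \<open>U\<close> through \<open>V\<close>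
  leaves on every slice \<open>t > 0\<close> the factor \<open>exp (- \<i> eps H\<^sub>t)\<close>, and on slice \<open>0\<close> the factor
  \<open>exp (\<i> eps (N - 1) H\<^sub>0)\<close>, which the prefactor \<open>exp (- \<i> T H\<^sub>0)\<close> corrects.

  The inverse of \<open>V\<close> is its adjoint because each \<open>H\<^sub>t\<close> is hermitian. For \<open>t = 0\<close> this is
  read off the Jordan-Wigner matrices, in which \<open>H\<^sub>0\<close> is block diagonal with copies of \<open>H\<close>; the other
  slices follow by conjugation with the unitary \<open>U\<close>.
\<close>

subsection \<open>Matrix exponential and adjoint\<close>

lemma smult_smult_mat: "a \<cdot>\<^sub>m (b \<cdot>\<^sub>m A) = (a * b :: 'a :: comm_ring_1) \<cdot>\<^sub>m A"
  by (rule eq_matI) (auto simp: mult.assoc)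

lemma mat_pow_intertwine:
  fixes A B X :: "'a :: comm_ring_1 mat"
  assumes A: "A \<in> carrier_mat n n" and B: "B \<in> carrier_mat m m" and X: "X \<in> carrier_mat m n"
    and eq: "X * A = B * X"
  shows "X * A ^\<^sub>m k = B ^\<^sub>m k * X"
proof (induction k)
  case 0
  show ?case using A B X by simp
next
  case (Suc k)
  have pA: "A ^\<^sub>m k \<in> carrier_mat n n" and pB: "B ^\<^sub>m k \<in> carrier_mat m m"
    using A B by auto
  have "X * A ^\<^sub>m Suc k = X * A ^\<^sub>m k * A"
    using assoc_mult_mat[OF X pA A] by simp
  also have "\<dots> = B ^\<^sub>m k * (X * A)"
    using Suc assoc_mult_mat[OF pB X A] by simp
  also have "\<dots> = B ^\<^sub>m Suc k * X"
    using eq assoc_mult_mat[OF pB B X] by simp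
  finally show ?case .
qed

lemma index_mult_mat_sum:
  assumes "A \<in> carrier_mat n m" "B \<in> carrier_mat m k" "i < n" "j < k"
  shows "(A * B) $$ (i, j) = (\<Sum>l<m. A $$ (i, l) * B $$ (l, j))"
  using assms by (auto simp: scalar_prod_def lessThan_atLeast0 intro!: sum.cong)

lemma norm_pow_mat_entry_le:
  fixes A :: "complex mat"
  assumes A: "A \<in> carrier_mat n n"
    and c: "\<And>i j. i < n \<Longrightarrow> j < n \<Longrightarrow> norm (A $$ (i, j)) \<le> c"
    and ij: "i < n" "j < n"
  shows "norm ((A ^\<^sub>m k) $$ (i, j)) \<le> (real n * c) ^ k"
  using ij
proof (induction k arbitrary: i j)
  case 0
  then show ?case using A by simp
next
  case (Suc k)
  have c0: "0 \<le> c" using c[OF Suc.prems] norm_ge_zero order_trans by blast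
  have "(A ^\<^sub>m Suc k) $$ (i, j) = (\<Sum>l<n. (A ^\<^sub>m k) $$ (i, l) * A $$ (l, j))"
    using index_mult_mat_sum[of "A ^\<^sub>m k" n n A n i j] A Suc.prems by simp
  also have "norm \<dots> \<le> (\<Sum>l<n. (real n * c) ^ k * c)"
    using Suc c c0 by (intro sum_norm_le) (auto simp: norm_mult intro!: mult_mono)
  also have "\<dots> = (real n * c) ^ Suc k" by simp
  finally show ?case .
qed

lemma summable_norm_mexp_entry:
  fixes A :: "complex mat"
  assumes A: "A \<in> carrier_mat n n" and ij: "i < n" "j < n"
  shows "summable (\<lambda>k. norm ((A ^\<^sub>m k) $$ (i, j) / of_nat (fact k)))"
proof -
  define c where "c = Max ((\<lambda>(i, j). norm (A $$ (i, j))) ` ({..<n} \<times> {..<n}))"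
  have c: "norm (A $$ (i, j)) \<le> c" if "i < n" "j < n" for i j
    unfolding c_def using that by (intro Max_ge) force+
  have "summable (\<lambda>k. inverse (fact k) * (real n * c) ^ k)" by (rule summable_exp)
  then show ?thesis
  proof (rule summable_comparison_test')
    fix k :: nat
    show "norm (norm ((A ^\<^sub>m k) $$ (i, j) / of_nat (fact k))) \<le> inverse (fact k) * (real n * c) ^ k"
      using norm_pow_mat_entry_le[OF A c ij, of k] by (simp add: norm_divide field_simps)
  qed
qed

lemmas summable_mexp_entry = summable_norm_cancel[OF summable_norm_mexp_entry]

lemma mexp_carrier [simp]: "A \<in> carrier_mat n n \<Longrightarrow> mexp A \<in> carrier_mat n n"
  by (auto simp: mexp_def)

lemma mexp_index:
  "A \<in> carrier_mat n n \<Longrightarrow> i < n \<Longrightarrow> j < n \<Longrightarrow>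
    mexp A $$ (i, j) = (\<Sum>k. (A ^\<^sub>m k) $$ (i, j) / of_nat (fact k))"
  by (auto simp: mexp_def)

lemma mexp_intertwine:
  assumes A: "A \<in> carrier_mat n n" and B: "B \<in> carrier_mat m m" and X: "X \<in> carrier_mat m n"
    and eq: "X * A = B * X"
  shows "X * mexp A = mexp B * X"
proof (rule eq_matI)
  fix i j assume "i < dim_row (mexp B * X)" "j < dim_col (mexp B * X)"
  then have i: "i < m" and j: "j < n" using X mexp_carrier[OF B] by auto
  have "(X * mexp A) $$ (i, j) = (\<Sum>l<n. X $$ (i, l) * (\<Sum>k. (A ^\<^sub>m k) $$ (l, j) / of_nat (fact k)))"
    using index_mult_mat_sum[OF X mexp_carrier[OF A] i j] mexp_index[OF A _ j] by simp
  also have "\<dots> = (\<Sum>l<n. \<Sum>k. X $$ (i, l) * ((A ^\<^sub>m k) $$ (l, j) / of_nat (fact k)))"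
    by (intro sum.cong refl suminf_mult[symmetric] summable_mexp_entry[OF A _ j]) auto
  also have "\<dots> = (\<Sum>k. \<Sum>l<n. X $$ (i, l) * ((A ^\<^sub>m k) $$ (l, j) / of_nat (fact k)))"
    by (intro suminf_sum[symmetric] summable_mult summable_mexp_entry[OF A _ j]) auto
  also have "\<dots> = (\<Sum>k. (X * A ^\<^sub>m k) $$ (i, j) / of_nat (fact k))"
    using index_mult_mat_sum[OF X pow_carrier_mat[OF A] i j] by (simp add: sum_divide_distrib)
  also have "\<dots> = (\<Sum>k. (B ^\<^sub>m k * X) $$ (i, j) / of_nat (fact k))"
    using mat_pow_intertwine[OF A B X eq] by simp
  also have "\<dots> = (\<Sum>k. \<Sum>l<m. ((B ^\<^sub>m k) $$ (i, l) / of_nat (fact k)) * X $$ (l, j))"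
    using index_mult_mat_sum[OF pow_carrier_mat[OF B] X i j] by (simp add: sum_divide_distrib)
  also have "\<dots> = (\<Sum>l<m. \<Sum>k. ((B ^\<^sub>m k) $$ (i, l) / of_nat (fact k)) * X $$ (l, j))"
    by (intro suminf_sum summable_mult2 summable_mexp_entry[OF B i]) auto
  also have "\<dots> = (\<Sum>l<m. (\<Sum>k. (B ^\<^sub>m k) $$ (i, l) / of_nat (fact k)) * X $$ (l, j))"
    by (intro sum.cong refl suminf_mult2[symmetric] summable_mexp_entry[OF B i]) auto
  also have "\<dots> = (mexp B * X) $$ (i, j)"
    using index_mult_mat_sum[OF mexp_carrier[OF B] X i j] mexp_index[OF B i] by simp
  finally show "(X * mexp A) $$ (i, j) = (mexp B * X) $$ (i, j)" .
qed (use A B X in \<open>auto simp: mexp_def\<close>)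

lemma mat_binomial_entry:
  fixes A B :: "'a :: comm_ring_1 mat"
  assumes A: "A \<in> carrier_mat n n" and B: "B \<in> carrier_mat n n" and comm: "A * B = B * A"
    and ij: "i < n" "j < n"
  shows "((A + B) ^\<^sub>m k) $$ (i, j)
    = (\<Sum>l\<le>k. of_nat (k choose l) * (A ^\<^sub>m l * B ^\<^sub>m (k - l)) $$ (i, j))"
  using ij
proof (induction k arbitrary: i j)
  case 0
  then show ?case using A B by simp
next
  case (Suc k)
  define f where "f l r = (A ^\<^sub>m l * B ^\<^sub>m r) $$ (i, j)" for l r
  have pA: "A ^\<^sub>m l \<in> carrier_mat n n" and pB: "B ^\<^sub>m l \<in> carrier_mat n n" for l
    using A B by auto
  have AB: "A ^\<^sub>m l * B ^\<^sub>m r \<in> carrier_mat n n" for l r using pA pB by (meson mult_carrier_mat)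
  have mA: "A ^\<^sub>m l * B ^\<^sub>m r * A = A ^\<^sub>m Suc l * B ^\<^sub>m r" for l r
  proof -
    have "A ^\<^sub>m l * B ^\<^sub>m r * A = A ^\<^sub>m l * (B ^\<^sub>m r * A)"
      by (rule assoc_mult_mat[OF pA pB A])
    also have "B ^\<^sub>m r * A = A * B ^\<^sub>m r" using mat_pow_intertwine[OF B B A comm] by simp
    also have "A ^\<^sub>m l * (A * B ^\<^sub>m r) = A ^\<^sub>m Suc l * B ^\<^sub>m r"
      using assoc_mult_mat[OF pA A pB] by simp
    finally show ?thesis .
  qed
  have mB: "A ^\<^sub>m l * B ^\<^sub>m r * B = A ^\<^sub>m l * B ^\<^sub>m Suc r" for l r
    using assoc_mult_mat[OF pA pB B] by simp
  have step: "(\<Sum>x<n. (A ^\<^sub>m l * B ^\<^sub>m r) $$ (i, x) * (A + B) $$ (x, j)) = f (Suc l) r + f l (Suc r)" for l r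
  proof -
    have "(\<Sum>x<n. (A ^\<^sub>m l * B ^\<^sub>m r) $$ (i, x) * (A + B) $$ (x, j))
      = (A ^\<^sub>m l * B ^\<^sub>m r * (A + B)) $$ (i, j)"
      using index_mult_mat_sum[OF AB, of "A + B" n i j l r] A B Suc.prems by simp
    also have "A ^\<^sub>m l * B ^\<^sub>m r * (A + B) = A ^\<^sub>m Suc l * B ^\<^sub>m r + A ^\<^sub>m l * B ^\<^sub>m Suc r"
      using mult_add_distrib_mat[OF AB A B] mA mB by simp
    also have "\<dots> $$ (i, j) = f (Suc l) r + f l (Suc r)"
      using AB[of l "Suc r"] Suc.prems unfolding f_def by (intro index_add_mat) auto
    finally show ?thesis .
  qed
  have "((A + B) ^\<^sub>m Suc k) $$ (i, j) = (\<Sum>x<n. ((A + B) ^\<^sub>m k) $$ (i, x) * (A + B) $$ (x, j))"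
    using index_mult_mat_sum[of "(A + B) ^\<^sub>m k" n n "A + B" n i j] A B Suc.prems by simp
  also have "\<dots> = (\<Sum>x<n. \<Sum>l\<le>k. of_nat (k choose l) *
      ((A ^\<^sub>m l * B ^\<^sub>m (k - l)) $$ (i, x) * (A + B) $$ (x, j)))"
    by (intro sum.cong refl) (simp add: Suc.IH Suc.prems sum_distrib_right mult.assoc)
  also have "\<dots> = (\<Sum>l\<le>k. of_nat (k choose l) * (f (Suc l) (k - l) + f l (Suc (k - l))))"
    by (subst sum.swap) (simp add: step flip: sum_distrib_left)
  also have "\<dots> = (\<Sum>l\<le>k. of_nat (k choose l) * f (Suc l) (k - l))
      + (\<Sum>l\<le>k. of_nat (k choose l) * f l (Suc k - l))"
    by (simp add: distrib_left sum.distrib Suc_diff_le)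
  also have "(\<Sum>l\<le>k. of_nat (k choose l) * f l (Suc k - l))
      = (\<Sum>l\<le>Suc k. of_nat (k choose l) * f l (Suc k - l))"
    by (simp add: binomial_eq_0)
  also have "\<dots> = f 0 (Suc k) + (\<Sum>l\<le>k. of_nat (k choose Suc l) * f (Suc l) (k - l))"
    by (subst sum.atMost_Suc_shift) simp
  also have "(\<Sum>l\<le>k. of_nat (k choose l) * f (Suc l) (k - l))
      + (f 0 (Suc k) + (\<Sum>l\<le>k. of_nat (k choose Suc l) * f (Suc l) (k - l)))
      = (\<Sum>l\<le>Suc k. of_nat (Suc k choose l) * f l (Suc k - l))"
    by (subst sum.atMost_Suc_shift) (simp add: sum.distrib distrib_right)
  finally show ?case unfolding f_def .
qed

lemma mexp_add:
  assumes A: "A \<in> carrier_mat n n" and B: "B \<in> carrier_mat n n" and comm: "A * B = B * A"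
  shows "mexp (A + B) = mexp A * mexp B"
proof (rule eq_matI)
  have AB: "A + B \<in> carrier_mat n n" using A B by simp
  fix i j assume "i < dim_row (mexp A * mexp B)" "j < dim_col (mexp A * mexp B)"
  then have i: "i < n" and j: "j < n" using mexp_carrier[OF A] mexp_carrier[OF B] by auto
  define a where "a k l = (A ^\<^sub>m k) $$ (i, l) / of_nat (fact k)" for k l
  define b where "b k l = (B ^\<^sub>m k) $$ (l, j) / of_nat (fact k)" for k l
  have sa: "summable (\<lambda>k. norm (a k l))" and sb: "summable (\<lambda>k. norm (b k l))" if "l < n" for l
    unfolding a_def b_def using summable_norm_mexp_entry A B i j that by blast+
  have "(mexp A * mexp B) $$ (i, j) = (\<Sum>l<n. (\<Sum>k. a k l) * (\<Sum>k. b k l))"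
    using index_mult_mat_sum[OF mexp_carrier[OF A] mexp_carrier[OF B] i j]
      mexp_index[OF A i] mexp_index[OF B _ j] by (simp add: a_def b_def)
  also have "\<dots> = (\<Sum>l<n. \<Sum>k. \<Sum>r\<le>k. a r l * b (k - r) l)"
    by (intro sum.cong refl Cauchy_product sa sb) auto
  also have "\<dots> = (\<Sum>k. \<Sum>l<n. \<Sum>r\<le>k. a r l * b (k - r) l)"
    by (intro suminf_sum[symmetric] summable_Cauchy_product sa sb) auto
  also have "\<dots> = (\<Sum>k. ((A + B) ^\<^sub>m k) $$ (i, j) / of_nat (fact k))"
  proof (intro suminf_cong)
    fix k
    have "(\<Sum>l<n. \<Sum>r\<le>k. a r l * b (k - r) l) = (\<Sum>r\<le>k. \<Sum>l<n. a r l * b (k - r) l)"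
      by (rule sum.swap)
    also have "\<dots> = (\<Sum>r\<le>k. of_nat (k choose r) * (A ^\<^sub>m r * B ^\<^sub>m (k - r)) $$ (i, j) / of_nat (fact k))"
    proof (intro sum.cong refl)
      fix r assume r: "r \<in> {..k}"
      have "(\<Sum>l<n. a r l * b (k - r) l)
        = (\<Sum>l<n. (A ^\<^sub>m r) $$ (i, l) * (B ^\<^sub>m (k - r)) $$ (l, j)) / (of_nat (fact r) * of_nat (fact (k - r)))"
        by (simp add: a_def b_def sum_divide_distrib)
      also have "(\<Sum>l<n. (A ^\<^sub>m r) $$ (i, l) * (B ^\<^sub>m (k - r)) $$ (l, j)) = (A ^\<^sub>m r * B ^\<^sub>m (k - r)) $$ (i, j)"
        using index_mult_mat_sum[OF pow_carrier_mat[OF A] pow_carrier_mat[OF B] i j] by simp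
      also have "\<dots> / (of_nat (fact r) * of_nat (fact (k - r)))
        = of_nat (k choose r) * (A ^\<^sub>m r * B ^\<^sub>m (k - r)) $$ (i, j) / of_nat (fact k)"
        using r by (simp add: binomial_fact field_simps)
      finally show "(\<Sum>l<n. a r l * b (k - r) l)
        = of_nat (k choose r) * (A ^\<^sub>m r * B ^\<^sub>m (k - r)) $$ (i, j) / of_nat (fact k)" .
    qed
    also have "\<dots> = ((A + B) ^\<^sub>m k) $$ (i, j) / of_nat (fact k)"
      by (simp add: mat_binomial_entry[OF A B comm i j] sum_divide_distrib)
    finally show "(\<Sum>l<n. \<Sum>r\<le>k. a r l * b (k - r) l) = ((A + B) ^\<^sub>m k) $$ (i, j) / of_nat (fact k)" .
  qed
  also have "\<dots> = mexp (A + B) $$ (i, j)" using mexp_index[OF AB i j] by simp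
  finally show "mexp (A + B) $$ (i, j) = (mexp A * mexp B) $$ (i, j)" by simp
qed (use A B in \<open>auto simp: mexp_def\<close>)

lemma pow_smult_one_mat:
  "((c :: 'a :: comm_ring_1) \<cdot>\<^sub>m 1\<^sub>m n) ^\<^sub>m k = c ^ k \<cdot>\<^sub>m 1\<^sub>m n"
  by (induction k) (auto simp: mult.commute)

lemma mexp_smult_one_mat: "mexp (c \<cdot>\<^sub>m 1\<^sub>m n) = exp c \<cdot>\<^sub>m 1\<^sub>m n"
proof (rule eq_matI)
  fix i j assume ij: "i < dim_row (exp c \<cdot>\<^sub>m 1\<^sub>m n)" "j < dim_col (exp c \<cdot>\<^sub>m 1\<^sub>m n)"
  have "exp c = (\<Sum>k. c ^ k / of_nat (fact k))"
    by (simp add: exp_def scaleR_conv_of_real field_simps)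
  then show "mexp (c \<cdot>\<^sub>m 1\<^sub>m n) $$ (i, j) = (exp c \<cdot>\<^sub>m 1\<^sub>m n) $$ (i, j)"
    using ij by (simp add: mexp_def pow_smult_one_mat)
qed (auto simp: mexp_def)

lemma mexp_zero_mat: "mexp (0\<^sub>m n n) = 1\<^sub>m n"
proof -
  have "(0\<^sub>m n n :: complex mat) = 0 \<cdot>\<^sub>m 1\<^sub>m n" by (rule eq_matI) auto
  then show ?thesis by (simp only: mexp_smult_one_mat) (rule eq_matI; simp)
qed

lemma dagger_carrier [simp]: "A \<in> carrier_mat n m \<Longrightarrow> dagger A \<in> carrier_mat m n"
  by (auto simp: dagger_def)

lemma dagger_index: "A \<in> carrier_mat n m \<Longrightarrow> i < m \<Longrightarrow> j < n \<Longrightarrow> dagger A $$ (i, j) = cnj (A $$ (j, i))"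
  by (auto simp: dagger_def)

lemma dagger_dagger [simp]: "dagger (dagger A) = A"
  by (rule eq_matI) (auto simp: dagger_def)

lemma dagger_one [simp]: "dagger (1\<^sub>m n) = 1\<^sub>m n"
  by (rule eq_matI) (auto simp: dagger_def)

lemma dagger_zero [simp]: "dagger (0\<^sub>m n m) = 0\<^sub>m m n"
  by (rule eq_matI) (auto simp: dagger_def)

lemma dagger_smult: "dagger (c \<cdot>\<^sub>m A) = cnj c \<cdot>\<^sub>m dagger A"
  by (rule eq_matI) (auto simp: dagger_def)

lemma dagger_add:
  assumes "A \<in> carrier_mat n m" "B \<in> carrier_mat n m"
  shows "dagger (A + B) = dagger A + dagger B"
  using assms by (intro eq_matI) (auto simp: dagger_def)

lemma dagger_mult:
  assumes A: "A \<in> carrier_mat n m" and B: "B \<in> carrier_mat m k"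
  shows "dagger (A * B) = dagger B * dagger A"
proof (rule eq_matI)
  fix i j assume "i < dim_row (dagger B * dagger A)" "j < dim_col (dagger B * dagger A)"
  then have i: "i < k" and j: "j < n"
    using dagger_carrier[OF A] dagger_carrier[OF B] by auto
  show "dagger (A * B) $$ (i, j) = (dagger B * dagger A) $$ (i, j)"
    using index_mult_mat_sum[OF A B j i] index_mult_mat_sum[OF dagger_carrier[OF B] dagger_carrier[OF A] i j]
      dagger_index[OF mult_carrier_mat[OF A B] i j] dagger_index[OF B i] dagger_index[OF A _ j]
    by (simp add: mult.commute)
qed (use A B in \<open>auto simp: dagger_def\<close>)

lemma dagger_pow:
  assumes A: "A \<in> carrier_mat n n"
  shows "dagger (A ^\<^sub>m k) = dagger A ^\<^sub>m k"
proof (induction k)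
  case 0
  show ?case using A by (simp add: dagger_def) (rule eq_matI; simp)
next
  case (Suc k)
  have dA: "dagger A \<in> carrier_mat n n" using A by simp
  have "dagger (A ^\<^sub>m Suc k) = dagger A * dagger A ^\<^sub>m k"
    using dagger_mult[OF pow_carrier_mat[OF A] A] Suc by simp
  also have "\<dots> = dagger A ^\<^sub>m Suc k"
    using mat_pow_intertwine[OF dA dA dA refl] by simp
  finally show ?case .
qed

lemma dagger_mexp:
  assumes A: "A \<in> carrier_mat n n"
  shows "dagger (mexp A) = mexp (dagger A)"
proof (rule eq_matI)
  have dA: "dagger A \<in> carrier_mat n n" using A by simp
  fix i j assume "i < dim_row (mexp (dagger A))" "j < dim_col (mexp (dagger A))"
  then have i: "i < n" and j: "j < n" using mexp_carrier[OF dA] by auto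
  have "dagger (mexp A) $$ (i, j) = cnj (\<Sum>k. (A ^\<^sub>m k) $$ (j, i) / of_nat (fact k))"
    using dagger_index[OF mexp_carrier[OF A] i j] mexp_index[OF A j i] by simp
  also have "\<dots> = (\<Sum>k. cnj ((A ^\<^sub>m k) $$ (j, i) / of_nat (fact k)))"
    by (rule bounded_linear.suminf[OF bounded_linear_cnj summable_mexp_entry[OF A j i]])
  also have "\<dots> = mexp (dagger A) $$ (i, j)"
    using dagger_index[OF pow_carrier_mat[OF A] i j] by (simp add: mexp_index[OF dA i j] dagger_pow[OF A])
  finally show "dagger (mexp A) $$ (i, j) = mexp (dagger A) $$ (i, j)" .
qed (use A in \<open>auto simp: dagger_def mexp_def\<close>)

lemma mexp_smult_add:
  assumes A: "A \<in> carrier_mat n n"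
  shows "mexp (c \<cdot>\<^sub>m A) * mexp (d \<cdot>\<^sub>m A) = mexp ((c + d) \<cdot>\<^sub>m A)"
proof -
  have "c \<cdot>\<^sub>m A * (d \<cdot>\<^sub>m A) = d \<cdot>\<^sub>m A * (c \<cdot>\<^sub>m A)"
    using A by (simp add: mult_smult_distrib[of _ n n _ n] mult_smult_assoc_mat[of _ n n _ n] smult_smult_mat mult.commute)
  then show ?thesis
    using mexp_add[of "c \<cdot>\<^sub>m A" n "d \<cdot>\<^sub>m A"] A by (simp add: add_smult_distrib_right_mat)
qed

lemma mexp_smult_intertwine:
  assumes A: "A \<in> carrier_mat n n" and B: "B \<in> carrier_mat m m" and X: "X \<in> carrier_mat m n"
    and eq: "X * A = B * X"
  shows "X * mexp (c \<cdot>\<^sub>m A) = mexp (c \<cdot>\<^sub>m B) * X"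
  using assms by (intro mexp_intertwine[of _ n _ m]) (auto simp: mult_smult_distrib[of _ m n _ n] mult_smult_assoc_mat[of _ m m _ n])

lemma mexp_lowering:
  assumes P: "P \<in> carrier_mat n n" and A: "A \<in> carrier_mat n n"
    and low: "P * A + w \<cdot>\<^sub>m A = A * P"
  shows "mexp (c \<cdot>\<^sub>m P) * A = exp (- (c * w)) \<cdot>\<^sub>m (A * mexp (c \<cdot>\<^sub>m P))"
proof -
  define Q where "Q = c \<cdot>\<^sub>m P + (- (c * w)) \<cdot>\<^sub>m 1\<^sub>m n"
  have cP: "c \<cdot>\<^sub>m P \<in> carrier_mat n n" and Q: "Q \<in> carrier_mat n n"
    using P by (auto simp: Q_def)
  have m: "mexp Q = exp (- (c * w)) \<cdot>\<^sub>m mexp (c \<cdot>\<^sub>m P)"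
    unfolding Q_def using mexp_add[of "c \<cdot>\<^sub>m P" n "(- (c * w)) \<cdot>\<^sub>m 1\<^sub>m n"] P mexp_carrier[OF cP]
    by (simp add: mult_smult_distrib[of _ n n _ n] mult_smult_assoc_mat[of _ n n _ n]
        mexp_smult_one_mat smult_smult_mat mult.commute)
  have "A * Q = c \<cdot>\<^sub>m (A * P) + (- (c * w)) \<cdot>\<^sub>m A"
    unfolding Q_def using P A by (simp add: mult_add_distrib_mat[of _ n n _ n] mult_smult_distrib[of _ n n _ n])
  also have "\<dots> = c \<cdot>\<^sub>m P * A"
    unfolding low[symmetric] using P A
    by (intro eq_matI) (auto simp: mult_smult_assoc_mat[of _ n n _ n] algebra_simps simp del: index_mult_mat(1))
  finally have "A * mexp Q = mexp (c \<cdot>\<^sub>m P) * A"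
    by (rule mexp_intertwine[OF Q cP A])
  then show ?thesis unfolding m using A mexp_carrier[OF cP] by (simp add: mult_smult_distrib[of _ n n _ n])
qed

subsection \<open>Sums and anticommutators of matrices\<close>

abbreviation mat_sum :: "nat \<Rightarrow> ('a \<Rightarrow> complex mat) \<Rightarrow> 'a list \<Rightarrow> complex mat" where
  "mat_sum n F xs \<equiv> foldr (+) (map F xs) (0\<^sub>m n n)"

lemma mat_sum_carrier [simp]:
  "(\<And>x. x \<in> set xs \<Longrightarrow> F x \<in> carrier_mat n n) \<Longrightarrow> mat_sum n F xs \<in> carrier_mat n n"
  by (induction xs) auto

lemma mat_sum_index:
  "(\<And>x. x \<in> set xs \<Longrightarrow> F x \<in> carrier_mat n n) \<Longrightarrow> i < n \<Longrightarrow> j < n \<Longrightarrow>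
    mat_sum n F xs $$ (i, j) = (\<Sum>x\<leftarrow>xs. F x $$ (i, j))"
proof (induction xs)
  case (Cons x xs)
  then have "mat_sum n F xs \<in> carrier_mat n n" by simp
  from carrier_matD[OF this] Cons show ?case by simp
qed simp

lemma mat_sum_cong:
  "(\<And>x. x \<in> set xs \<Longrightarrow> F x = G x) \<Longrightarrow> mat_sum n F xs = mat_sum n G xs"
  by (induction xs) auto

lemma mult_mat_sum:
  assumes X: "X \<in> carrier_mat n n" and F: "\<And>x. x \<in> set xs \<Longrightarrow> F x \<in> carrier_mat n n"
  shows "X * mat_sum n F xs = mat_sum n (\<lambda>x. X * F x) xs"
  using F
proof (induction xs)
  case (Cons x xs)
  then show ?case using mult_add_distrib_mat[OF X, of "F x" n "mat_sum n F xs"] by simp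
qed (use X in simp)

lemma mat_sum_mult:
  assumes X: "X \<in> carrier_mat n n" and F: "\<And>x. x \<in> set xs \<Longrightarrow> F x \<in> carrier_mat n n"
  shows "mat_sum n F xs * X = mat_sum n (\<lambda>x. F x * X) xs"
  using F
proof (induction xs)
  case (Cons x xs)
  then show ?case using add_mult_distrib_mat[of "F x" n n "mat_sum n F xs", OF _ _ X] by simp
qed (use X in simp)

lemma mat_sum_add:
  assumes F: "\<And>x. x \<in> set xs \<Longrightarrow> F x \<in> carrier_mat n n" and G: "\<And>x. x \<in> set xs \<Longrightarrow> G x \<in> carrier_mat n n"
  shows "mat_sum n (\<lambda>x. F x + G x) xs = mat_sum n F xs + mat_sum n G xs"
proof (rule eq_matI)
  fix i j assume "i < dim_row (mat_sum n F xs + mat_sum n G xs)" "j < dim_col (mat_sum n F xs + mat_sum n G xs)"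
  moreover have c: "mat_sum n F xs \<in> carrier_mat n n" "mat_sum n G xs \<in> carrier_mat n n"
    using F G by simp_all
  ultimately have ij: "i < n" "j < n" by auto
  have "mat_sum n (\<lambda>x. F x + G x) xs $$ (i, j) = (\<Sum>x\<leftarrow>xs. (F x + G x) $$ (i, j))"
    using F G ij by (intro mat_sum_index) auto
  also have "\<dots> = (\<Sum>x\<leftarrow>xs. F x $$ (i, j) + G x $$ (i, j))"
    using F G ij by (intro arg_cong[of _ _ sum_list] map_cong refl index_add_mat) (metis carrier_matD)+
  also have "\<dots> = (mat_sum n F xs + mat_sum n G xs) $$ (i, j)"
    using carrier_matD[OF c(2)] ij F G by (simp add: sum_list_addf mat_sum_index)
  finally show "mat_sum n (\<lambda>x. F x + G x) xs $$ (i, j) = (mat_sum n F xs + mat_sum n G xs) $$ (i, j)" .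
next
  have "mat_sum n F xs \<in> carrier_mat n n" "mat_sum n G xs \<in> carrier_mat n n"
    "mat_sum n (\<lambda>x. F x + G x) xs \<in> carrier_mat n n" using F G by simp_all
  then show "dim_row (mat_sum n (\<lambda>x. F x + G x) xs) = dim_row (mat_sum n F xs + mat_sum n G xs)"
    "dim_col (mat_sum n (\<lambda>x. F x + G x) xs) = dim_col (mat_sum n F xs + mat_sum n G xs)" by auto
qed

lemma dagger_mat_sum:
  assumes F: "\<And>x. x \<in> set xs \<Longrightarrow> F x \<in> carrier_mat n n"
  shows "dagger (mat_sum n F xs) = mat_sum n (\<lambda>x. dagger (F x)) xs"
  using F
proof (induction xs)
  case (Cons x xs)
  then show ?case using dagger_add[of "F x" n n "mat_sum n F xs"] by simp
qed simp

lemma mat_sum_smult: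
  "mat_sum n (\<lambda>x. f x \<cdot>\<^sub>m A) xs = (\<Sum>x\<leftarrow>xs. f x) \<cdot>\<^sub>m A" if "A \<in> carrier_mat n n"
proof (induction xs)
  case Nil
  show ?case using that by (intro eq_matI) auto
next
  case (Cons x xs)
  then show ?case using that by (simp add: add_smult_distrib_right_mat)
qed

definition acomm :: "complex mat \<Rightarrow> complex mat \<Rightarrow> complex mat" where
  "acomm A B = A * B + B * A"

lemma acomm_commute:
  assumes "A \<in> carrier_mat n n" "B \<in> carrier_mat n n"
  shows "acomm A B = acomm B A"
  unfolding acomm_def using assms by (intro comm_add_mat[of _ n n]) auto

lemma acomm_smult_right:
  assumes "A \<in> carrier_mat n n" "B \<in> carrier_mat n n"
  shows "acomm A (c \<cdot>\<^sub>m B) = c \<cdot>\<^sub>m acomm A B"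
  using assms unfolding acomm_def
  by (simp add: mult_smult_distrib[of _ n n _ n] mult_smult_assoc_mat[of _ n n _ n]
      add_smult_distrib_left_mat[of _ n n])

lemma acomm_mat_sum_right:
  assumes X: "X \<in> carrier_mat n n" and F: "\<And>x. x \<in> set xs \<Longrightarrow> F x \<in> carrier_mat n n"
  shows "acomm X (mat_sum n F xs) = mat_sum n (\<lambda>x. acomm X (F x)) xs"
proof -
  have "mat_sum n (\<lambda>x. X * F x + F x * X) xs = mat_sum n (\<lambda>x. X * F x) xs + mat_sum n (\<lambda>x. F x * X) xs"
    using X F by (intro mat_sum_add) (auto intro: mult_carrier_mat)
  then show ?thesis unfolding acomm_def using mult_mat_sum[of X n xs F] mat_sum_mult[of X n xs F] X F by simp
qed

subsection \<open>Canonical anticommutation relations\<close>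

lemma flip_bit_less_exp: "b < 2 ^ M \<Longrightarrow> m < M \<Longrightarrow> flip_bit m b < (2 ^ M :: nat)"
  by (metis take_bit_nat_eq_self_iff take_bit_flip_bit_eq linorder_not_le)

lemma flip_bit_flip_bit [simp]: "flip_bit m (flip_bit m b) = (b :: nat)"
  by (rule bit_eqI) (auto simp: bit_flip_bit_iff)

lemma flip_bit_commute: "flip_bit m (flip_bit n b) = flip_bit n (flip_bit m (b :: nat))"
  by (rule bit_eqI) (auto simp: bit_flip_bit_iff)

lemma bit_imp_flip_bit_eq:
  assumes "bit (b :: nat) m"
  shows "b - 2 ^ m = flip_bit m b"
proof -
  have "set_bit m (flip_bit m b) = b"
    using assms by (intro bit_eqI) (auto simp: bit_set_bit_iff bit_flip_bit_iff)
  then have "b = flip_bit m b + 2 ^ m"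
    using assms by (simp add: set_bit_eq bit_flip_bit_iff)
  then show ?thesis by simp
qed

definition jw_sign :: "nat \<Rightarrow> nat \<Rightarrow> complex" where
  "jw_sign m b = (-1) ^ card {k. k < m \<and> bit b k}"

lemma jw_sign_flip_bit: "jw_sign m (flip_bit n b) = (if n < m then - jw_sign m b else jw_sign m b)"
proof (cases "n < m")
  case False
  then have "{k. k < m \<and> bit (flip_bit n b) k} = {k. k < m \<and> bit b k}"
    by (auto simp: bit_flip_bit_iff)
  with False show ?thesis by (simp add: jw_sign_def)
next
  case True
  have *: "jw_sign m b = - jw_sign m (flip_bit n b)" if "bit b n" for b
  proof -
    have "{k. k < m \<and> bit b k} = insert n {k. k < m \<and> bit (flip_bit n b) k}"
      using that True by (auto simp: bit_flip_bit_iff)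
    moreover have "n \<notin> {k. k < m \<and> bit (flip_bit n b) k}"
      using that by (auto simp: bit_flip_bit_iff)
    ultimately show ?thesis by (simp add: jw_sign_def)
  qed
  show ?thesis
  proof (cases "bit b n")
    case False
    then have "bit (flip_bit n b) n" by (simp add: bit_flip_bit_iff)
    from *[OF this] True show ?thesis by simp
  qed (use * True in simp)
qed

lemma jw_sign_square [simp]: "jw_sign m b * jw_sign m b = 1"
  by (simp add: jw_sign_def flip: power_add)

lemma ann_carrier [simp]: "ann M m \<in> carrier_mat (fock_dim M) (fock_dim M)"
  by (simp add: ann_def)

lemma ladder_carrier [simp]: "ladder M m d \<in> carrier_mat (fock_dim M) (fock_dim M)"
  by (simp add: ladder_def)

lemma dagger_ladder: "dagger (ladder M m d) = ladder M m (\<not> d)"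
  by (simp add: ladder_def)

lemma ladder_index:
  assumes "c < fock_dim M" "b < fock_dim M"
  shows "ladder M m d $$ (c, b) = (if bit b m \<noteq> d \<and> c = flip_bit m b then jw_sign m b else 0)"
proof (cases d)
  case False
  then show ?thesis using assms bit_imp_flip_bit_eq[of b m]
    by (auto simp: ladder_def ann_def jw_sign_def)
next
  case True
  have "bit c m \<and> b = c - 2 ^ m \<longleftrightarrow> \<not> bit b m \<and> c = flip_bit m b"
    using bit_imp_flip_bit_eq[of c m] by (auto simp: bit_flip_bit_iff)
  moreover have "jw_sign m (flip_bit m b) = jw_sign m b" by (simp add: jw_sign_flip_bit)
  ultimately show ?thesis using True assms
    using dagger_index[OF ann_carrier, of c M b m] bit_imp_flip_bit_eq[of c m]
    by (auto simp: ladder_def ann_def jw_sign_def)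
qed

lemma mult_ladder_index:
  assumes A: "A \<in> carrier_mat r (fock_dim M)" and c: "c < r" and b: "b < fock_dim M" and m: "m < M"
  shows "(A * ladder M m d) $$ (c, b) = (if bit b m \<noteq> d then jw_sign m b * A $$ (c, flip_bit m b) else 0)"
proof -
  have f: "flip_bit m b < fock_dim M" using flip_bit_less_exp b m by (simp add: fock_dim_def)
  have "(A * ladder M m d) $$ (c, b) = (\<Sum>l<fock_dim M. A $$ (c, l) * ladder M m d $$ (l, b))"
    by (rule index_mult_mat_sum[OF A ladder_carrier c b])
  also have "\<dots> = (\<Sum>l<fock_dim M. if l = flip_bit m b then (if bit b m \<noteq> d then jw_sign m b * A $$ (c, l) else 0) else 0)"
    by (intro sum.cong refl) (auto simp: ladder_index b)
  also have "\<dots> = (if bit b m \<noteq> d then jw_sign m b * A $$ (c, flip_bit m b) else 0)"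
    using f by simp
  finally show ?thesis .
qed

lemma acomm_ladder:
  assumes m: "m < M" and n: "n < M"
  shows "acomm (ladder M m d) (ladder M n e) = of_bool (m = n \<and> d \<noteq> e) \<cdot>\<^sub>m 1\<^sub>m (fock_dim M)"
proof (rule eq_matI)
  fix c b assume "c < dim_row (of_bool (m = n \<and> d \<noteq> e) \<cdot>\<^sub>m 1\<^sub>m (fock_dim M))"
    "b < dim_col (of_bool (m = n \<and> d \<noteq> e) \<cdot>\<^sub>m 1\<^sub>m (fock_dim M))"
  then have c: "c < fock_dim M" and b: "b < fock_dim M" by auto
  have f: "flip_bit m b < fock_dim M" "flip_bit n b < fock_dim M"
    using flip_bit_less_exp b m n by (simp_all add: fock_dim_def)
  have "acomm (ladder M m d) (ladder M n e) $$ (c, b)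
    = (ladder M m d * ladder M n e) $$ (c, b) + (ladder M n e * ladder M m d) $$ (c, b)"
    unfolding acomm_def using c b
    by (intro index_add_mat) (metis carrier_matD ladder_carrier mult_carrier_mat)+
  also have "\<dots> = (of_bool (m = n \<and> d \<noteq> e) \<cdot>\<^sub>m 1\<^sub>m (fock_dim M)) $$ (c, b)"
  proof (cases "m = n")
    case True
    then show ?thesis using c b f n
      by (auto simp: mult_ladder_index[of _ "fock_dim M"] ladder_index bit_flip_bit_iff jw_sign_flip_bit)
  next
    case False
    then show ?thesis using c b f n m
      by (auto simp: mult_ladder_index[of _ "fock_dim M"] ladder_index bit_flip_bit_iff jw_sign_flip_bit flip_bit_commute[of n m])
  qed
  finally show "acomm (ladder M m d) (ladder M n e) $$ (c, b)
    = (of_bool (m = n \<and> d \<noteq> e) \<cdot>\<^sub>m 1\<^sub>m (fock_dim M)) $$ (c, b)" .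
qed (auto simp: acomm_def carrier_matD[OF ladder_carrier])

subsection \<open>Even polynomials in the ladder operators\<close>

lemma foldr_mult_carrier [simp]:
  fixes F :: "'a \<Rightarrow> complex mat"
  shows "(\<And>x. x \<in> set xs \<Longrightarrow> F x \<in> carrier_mat n n) \<Longrightarrow> foldr (*) (map F xs) (1\<^sub>m n) \<in> carrier_mat n n"
  by (induction xs) (auto intro!: mult_carrier_mat)

lemma foldr_mult_intertwine:
  fixes F G :: "'a \<Rightarrow> complex mat"
  assumes X: "X \<in> carrier_mat m n"
    and F: "\<And>x. x \<in> set xs \<Longrightarrow> F x \<in> carrier_mat n n" and G: "\<And>x. x \<in> set xs \<Longrightarrow> G x \<in> carrier_mat m m"
    and eq: "\<And>x. x \<in> set xs \<Longrightarrow> X * F x = G x * X"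
  shows "X * foldr (*) (map F xs) (1\<^sub>m n) = foldr (*) (map G xs) (1\<^sub>m m) * X"
  using F G eq
proof (induction xs)
  case Nil
  show ?case using left_mult_one_mat[OF X] right_mult_one_mat[OF X] by simp
next
  case (Cons x xs)
  let ?f = "foldr (*) (map F xs) (1\<^sub>m n)" and ?g = "foldr (*) (map G xs) (1\<^sub>m m)"
  have f: "?f \<in> carrier_mat n n" and g: "?g \<in> carrier_mat m m"
    and Fx: "F x \<in> carrier_mat n n" and Gx: "G x \<in> carrier_mat m m" using Cons.prems by auto
  have "X * (F x * ?f) = X * F x * ?f" by (rule assoc_mult_mat[OF X Fx f, symmetric])
  also have "\<dots> = G x * (X * ?f)" using Cons.prems(3) assoc_mult_mat[OF Gx X f] by simp
  also have "\<dots> = G x * ?g * X" using Cons assoc_mult_mat[OF Gx g X] by simp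
  finally show ?case by simp
qed

abbreviation word_prod :: "nat \<Rightarrow> (nat \<Rightarrow> bool \<Rightarrow> complex mat) \<Rightarrow> (nat \<times> bool) list \<Rightarrow> complex mat" where
  "word_prod D lad w \<equiv> foldr (*) (map (\<lambda>(i, d). lad i d) w) (1\<^sub>m D)"

lemma eval_poly_Nil: "eval_poly D lad [] = 0\<^sub>m D D"
  and eval_poly_Cons: "eval_poly D lad ((c, w) # p) = c \<cdot>\<^sub>m word_prod D lad w + eval_poly D lad p"
  by (simp_all add: eval_poly_def)

lemma eval_poly_carrier:
  assumes "\<And>i d. lad i d \<in> carrier_mat D D"
  shows "eval_poly D lad p \<in> carrier_mat D D"
  unfolding eval_poly_def using assms
  by (intro mat_sum_carrier) (auto intro!: smult_carrier_mat foldr_mult_carrier)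

lemma eval_poly_intertwine:
  assumes X: "X \<in> carrier_mat m n"
    and F: "\<And>i d. F i d \<in> carrier_mat n n" and G: "\<And>i d. G i d \<in> carrier_mat m m"
    and p: "\<forall>(c, w) \<in> set p. \<forall>(i, d) \<in> set w. i < L"
    and eq: "\<And>i d. i < L \<Longrightarrow> X * F i d = G i d * X"
  shows "X * eval_poly n F p = eval_poly m G p * X"
  using p
proof (induction p)
  case Nil
  show ?case using X by (simp add: eval_poly_Nil)
next
  case (Cons cw p)
  obtain c w where cw: "cw = (c, w)" by fastforce
  have f: "word_prod n F w \<in> carrier_mat n n" and g: "word_prod m G w \<in> carrier_mat m m"
    using F G by (auto intro!: foldr_mult_carrier)
  have w: "X * word_prod n F w = word_prod m G w * X"
    using Cons.prems F G eq cw by (intro foldr_mult_intertwine[OF X]) auto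
  show ?case
    using X f g w Cons eval_poly_carrier[of F, OF F] eval_poly_carrier[of G, OF G]
    by (simp add: cw eval_poly_Cons mult_add_distrib_mat[of _ m n _ n] add_mult_distrib_mat[of _ m m _ _ n]
      mult_smult_distrib[of _ m n _ n] mult_smult_assoc_mat[of _ m m _ n])
qed

lemma word_prod_uminus:
  assumes "\<And>i d. lad i d \<in> carrier_mat D D"
  shows "word_prod D (\<lambda>i d. (-1) \<cdot>\<^sub>m lad i d) w = (-1) ^ length w \<cdot>\<^sub>m word_prod D lad w"
proof (induction w)
  case Nil
  show ?case by (rule eq_matI) auto
next
  case (Cons x w)
  obtain i d where x: "x = (i, d)" by fastforce
  have "word_prod D lad w \<in> carrier_mat D D" using assms by (auto intro!: foldr_mult_carrier)
  then show ?case using Cons assms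
    by (simp add: x mult_smult_distrib[of _ D D _ D] mult_smult_assoc_mat[of _ D D _ D] smult_smult_mat)
qed

lemma eval_poly_uminus:
  assumes "\<And>i d. lad i d \<in> carrier_mat D D" and "\<forall>(c, w) \<in> set p. even (length w)"
  shows "eval_poly D (\<lambda>i d. (-1) \<cdot>\<^sub>m lad i d) p = eval_poly D lad p"
  using assms(2)
proof (induction p)
  case (Cons cw p)
  obtain c w where cw: "cw = (c, w)" by fastforce
  have "(1 :: complex) \<cdot>\<^sub>m word_prod D lad w = word_prod D lad w" by (rule eq_matI) auto
  then show ?case using Cons assms(1) by (simp add: cw eval_poly_Cons word_prod_uminus)
qed (simp add: eval_poly_Nil)

lemma number_operator_lowering:
  assumes A: "A \<in> carrier_mat n n" and B: "B \<in> carrier_mat n n" and C: "C \<in> carrier_mat n n"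
    and BC: "acomm B C = 0\<^sub>m n n" and AC: "acomm A C = x \<cdot>\<^sub>m 1\<^sub>m n"
  shows "A * B * C + x \<cdot>\<^sub>m B = C * (A * B)"
proof -
  note [simp] = A B C mult_carrier_mat[of _ n n _ n]
  have "A * (B * C) + A * (C * B) = A * acomm B C"
    unfolding acomm_def by (rule mult_add_distrib_mat[of _ n n _ n, symmetric]) simp_all
  also have "\<dots> = 0\<^sub>m n n" unfolding BC using right_mult_zero_mat[OF A] by simp
  finally have 1: "A * (B * C) + A * (C * B) = 0\<^sub>m n n" .
  have "A * C * B + C * A * B = acomm A C * B"
    unfolding acomm_def by (rule add_mult_distrib_mat[of _ n n _ _ n, symmetric]) simp_all
  also have "\<dots> = x \<cdot>\<^sub>m B" unfolding AC by (simp add: mult_smult_assoc_mat[of _ n n _ n] left_mult_one_mat[OF B])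
  finally have 2: "A * (C * B) + C * (A * B) = x \<cdot>\<^sub>m B"
    by (simp add: assoc_mult_mat[of _ n n _ n _ n])
  have "A * (B * C) + x \<cdot>\<^sub>m B = A * (B * C) + A * (C * B) + C * (A * B)"
    unfolding 2[symmetric] by (rule assoc_add_mat[of _ n n, symmetric]) simp_all
  also have "\<dots> = C * (A * B)" unfolding 1 by (rule left_add_zero_mat) simp
  finally show ?thesis by (simp add: assoc_mult_mat[of _ n n _ n _ n])
qed

lemma unitary_dagger_intertwine:
  assumes U: "U \<in> carrier_mat n n" and A: "A \<in> carrier_mat n n" and B: "B \<in> carrier_mat n n"
    and unit: "U * dagger U = 1\<^sub>m n" "dagger U * U = 1\<^sub>m n" and eq: "U * A = B * U"
  shows "U * dagger A = dagger B * U"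
proof -
  note c [simp] = U A B mult_carrier_mat[of _ n n _ n] dagger_carrier[of _ n n]
  have dag: "dagger A * dagger U = dagger U * dagger B"
    using arg_cong[OF eq, of dagger] dagger_mult[OF U A] dagger_mult[OF B U] by simp
  have "U * dagger A = U * (dagger A * dagger U * U)"
    using unit(2) by (simp add: assoc_mult_mat[of _ n n _ n _ n] right_mult_one_mat[of _ n])
  also have "\<dots> = U * dagger U * dagger B * U"
    unfolding dag by (simp add: assoc_mult_mat[of _ n n _ n _ n])
  also have "\<dots> = dagger B * U" using unit(1) by (simp add: left_mult_one_mat[of _ n n])
  finally show ?thesis .
qed

lemma unitary_mexp:
  assumes P: "P \<in> carrier_mat n n" and herm: "dagger P = P"
  shows "dagger (mexp ((\<i> * complex_of_real r) \<cdot>\<^sub>m P)) = mexp ((- (\<i> * complex_of_real r)) \<cdot>\<^sub>m P)"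
    and "mexp ((\<i> * complex_of_real r) \<cdot>\<^sub>m P) * mexp ((- (\<i> * complex_of_real r)) \<cdot>\<^sub>m P) = 1\<^sub>m n"
    and "mexp ((- (\<i> * complex_of_real r)) \<cdot>\<^sub>m P) * mexp ((\<i> * complex_of_real r) \<cdot>\<^sub>m P) = 1\<^sub>m n"
proof -
  have "0 \<cdot>\<^sub>m P = 0\<^sub>m n n" using P by (intro eq_matI) auto
  then show "mexp ((\<i> * complex_of_real r) \<cdot>\<^sub>m P) * mexp ((- (\<i> * complex_of_real r)) \<cdot>\<^sub>m P) = 1\<^sub>m n"
    "mexp ((- (\<i> * complex_of_real r)) \<cdot>\<^sub>m P) * mexp ((\<i> * complex_of_real r) \<cdot>\<^sub>m P) = 1\<^sub>m n"
    by (simp_all add: mexp_smult_add[OF P] mexp_zero_mat)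
  show "dagger (mexp ((\<i> * complex_of_real r) \<cdot>\<^sub>m P)) = mexp ((- (\<i> * complex_of_real r)) \<cdot>\<^sub>m P)"
    using P herm by (simp add: dagger_mexp[of _ n] dagger_smult)
qed

subsection \<open>Time translations\<close>

lemma sum_cis_roots_of_unity:
  fixes d :: int
  assumes "N \<ge> 1" "\<bar>d\<bar> < int N"
  shows "(\<Sum>k<N. cis (2 * pi * real k * of_int d / real N)) = (if d = 0 then of_nat N else 0)"
proof (cases "d = 0")
  case False
  define z where "z = cis (2 * pi * of_int d / real N)"
  have zk: "cis (2 * pi * real k * of_int d / real N) = z ^ k" for k
    by (simp add: z_def DeMoivre mult_ac)
  have "z ^ N = cis (2 * pi * of_int d)" using assms by (simp add: z_def DeMoivre)
  then have zN: "z ^ N = 1" by (simp add: cis_multiple_2pi)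
  have "z \<noteq> 1"
  proof
    assume "z = 1"
    then have "cos (2 * pi * of_int d / real N) = 1" by (metis z_def cis.sel(1) one_complex.sel(1))
    then obtain m :: int where "2 * pi * of_int d / real N = of_int m * 2 * pi"
      unfolding cos_one_2pi_int by auto
    then have "of_int d = real_of_int m * real N" using assms by (simp add: field_simps)
    then have "d = m * int N" by (metis of_int_eq_iff of_int_mult of_int_of_nat_eq)
    with assms False show False
      by (metis abs_mult abs_of_nat dvd_imp_le_int dvd_triv_right linorder_not_le)
  qed
  then show ?thesis using False zN by (simp add: zk geometric_sum)
qed simp

locale time_lattice =
  fixes N L :: nat and eps :: real
  assumes N: "N \<ge> 1" and eps: "eps > 0"
begin

abbreviation D :: nat where "D \<equiv> fock_dim (N * L)"

abbreviation a :: "nat \<Rightarrow> nat \<Rightarrow> bool \<Rightarrow> complex mat" where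
  "a s i d \<equiv> ladder (N * L) (s * L + i) d"

definition fcoef :: "nat \<Rightarrow> nat \<Rightarrow> complex" where
  "fcoef n t = exp (\<i> * complex_of_real (omega N eps n * eps * real t)) / complex_of_real (sqrt (real N))"

lemma fcoef_cis: "fcoef n t = cis ((2 * real n + 1) * pi * real t / real N) / complex_of_real (sqrt (real N))"
proof -
  have "omega N eps n * eps * real t = (2 * real n + 1) * pi * real t / real N"
    using eps by (simp add: omega_def)
  then show ?thesis unfolding fcoef_def by (simp only: cis_conv_exp)
qed

lemma cnj_fcoef_mult:
  "cnj (fcoef n s) * fcoef m t =
    cis (((2 * real m + 1) * real t - (2 * real n + 1) * real s) * pi / real N) / of_nat N"
proof -
  have "cnj (fcoef n s) * fcoef m t = cis (- ((2 * real n + 1) * pi * real s / real N)) *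
      cis ((2 * real m + 1) * pi * real t / real N) / (complex_of_real (sqrt (real N)) * complex_of_real (sqrt (real N)))"
    by (simp add: fcoef_cis cis_cnj)
  also have "complex_of_real (sqrt (real N)) * complex_of_real (sqrt (real N)) = of_nat N"
    by (metis of_nat_0_le_iff of_real_mult of_real_of_nat_eq real_sqrt_mult_self abs_of_nonneg)
  also have "cis (- ((2 * real n + 1) * pi * real s / real N)) * cis ((2 * real m + 1) * pi * real t / real N)
      = cis (((2 * real m + 1) * real t - (2 * real n + 1) * real s) * pi / real N)"
    unfolding cis_mult by (rule arg_cong[of _ _ cis]) (simp add: diff_divide_distrib algebra_simps)
  finally show ?thesis .
qed

lemma fcoef_orthogonal_time:
  assumes "n < N" "m < N"
  shows "(\<Sum>t<N. cnj (fcoef n t) * fcoef m t) = of_bool (n = m)"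
proof -
  have "(\<Sum>t<N. cnj (fcoef n t) * fcoef m t)
    = (\<Sum>t<N. cis (2 * pi * real t * of_int (int m - int n) / real N)) / of_nat N"
    unfolding cnj_fcoef_mult sum_divide_distrib
    by (intro sum.cong refl arg_cong2[of _ _ _ _ "(/)"] arg_cong[of _ _ cis]) (simp add: algebra_simps)
  then show ?thesis using assms N by (subst (asm) sum_cis_roots_of_unity) auto
qed

lemma fcoef_orthogonal_frequency:
  assumes "s < N" "t < N"
  shows "(\<Sum>n<N. cnj (fcoef n s) * fcoef n t) = of_bool (s = t)"
proof -
  have "(\<Sum>n<N. cnj (fcoef n s) * fcoef n t)
    = (\<Sum>n<N. cis ((real t - real s) * pi / real N) * cis (2 * pi * real n * of_int (int t - int s) / real N)) / of_nat N"
    unfolding cnj_fcoef_mult sum_divide_distrib cis_mult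
    by (intro sum.cong refl arg_cong2[of _ _ _ _ "(/)"] arg_cong[of _ _ cis])
      (simp add: algebra_simps diff_divide_distrib add_divide_distrib)
  also have "\<dots> = cis ((real t - real s) * pi / real N) *
      (\<Sum>n<N. cis (2 * pi * real n * of_int (int t - int s) / real N)) / of_nat N"
    by (simp add: sum_distrib_left)
  finally show ?thesis using assms N by (subst (asm) sum_cis_roots_of_unity) auto
qed

lemma cnj_fcoef_Suc:
  "cnj (fcoef n (Suc t)) = exp (- (\<i> * complex_of_real eps * complex_of_real (omega N eps n))) * cnj (fcoef n t)"
proof -
  have cnj_eq: "cnj (fcoef n t) = cis (- (omega N eps n * eps * real t)) / complex_of_real (sqrt (real N))" for t
    by (simp only: fcoef_def flip: cis_conv_exp) (simp add: cis_cnj)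
  have "exp (- (\<i> * complex_of_real eps * complex_of_real (omega N eps n))) = cis (- (omega N eps n * eps))"
    unfolding cis_conv_exp by (rule arg_cong[of _ _ exp]) simp
  then show ?thesis by (simp add: cnj_eq cis_mult algebra_simps)
qed

lemma fcoef_N: "fcoef n N = - fcoef n 0"
proof -
  have "cis ((2 * real n + 1) * pi * real N / real N) = cis (real n * (2 * pi)) * cis pi"
    unfolding cis_mult using N by (intro arg_cong[of _ _ cis]) (simp add: field_simps)
  also have "cis (real n * (2 * pi)) = 1"
    using cis_multiple_2pi[of "real n"] by (simp add: mult_ac)
  finally show ?thesis by (simp add: fcoef_cis)
qed

lemma mode_less: "s < N \<Longrightarrow> i < L \<Longrightarrow> s * L + i < N * L"
proof -
  assume "s < N" "i < L"
  then have "s * L + i < Suc s * L" "Suc s * L \<le> N * L" by (simp, intro mult_le_mono1, simp)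
  then show ?thesis by linarith
qed

lemma mode_eq_iff:
  assumes "i < L" "j < L"
  shows "s * L + i = t * L + j \<longleftrightarrow> s = t \<and> i = j"
proof
  assume eq: "s * L + i = t * L + j"
  have "(s * L + i) div L = s" "(t * L + j) div L = t" using assms by simp_all
  with eq show "s = t \<and> i = j" by simp
qed simp

lemma acomm_a:
  assumes "s < N" "t < N" "i < L" "j < L"
  shows "acomm (a s i d) (a t j e) = of_bool (s = t \<and> i = j \<and> d \<noteq> e) \<cdot>\<^sub>m 1\<^sub>m D"
  using assms by (simp add: acomm_ladder mode_less mode_eq_iff conj_assoc)

lemma ahat_eq: "ahat N L eps n j = mat_sum D (\<lambda>t. fcoef n t \<cdot>\<^sub>m a t j False) [0..<N]"
  by (simp add: ahat_def fcoef_def ladder_def)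

lemma ahat_carrier [simp]: "ahat N L eps n j \<in> carrier_mat D D"
  unfolding ahat_eq by (rule mat_sum_carrier) simp

lemma dagger_ahat_eq: "dagger (ahat N L eps n j) = mat_sum D (\<lambda>t. cnj (fcoef n t) \<cdot>\<^sub>m a t j True) [0..<N]"
  unfolding ahat_eq by (subst dagger_mat_sum) (simp_all add: dagger_smult dagger_ladder)

lemma acomm_a_ahat:
  assumes "s < N" "i < L" "j < L"
  shows "acomm (a s i d) (ahat N L eps n j) = (of_bool (d \<and> i = j) * fcoef n s) \<cdot>\<^sub>m 1\<^sub>m D"
proof -
  have "acomm (a s i d) (ahat N L eps n j)
    = mat_sum D (\<lambda>t. acomm (a s i d) (fcoef n t \<cdot>\<^sub>m a t j False)) [0..<N]"
    unfolding ahat_eq by (rule acomm_mat_sum_right) simp_all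
  also have "\<dots> = mat_sum D (\<lambda>t. (if t = s then of_bool (d \<and> i = j) * fcoef n s else 0) \<cdot>\<^sub>m 1\<^sub>m D) [0..<N]"
    using assms by (intro mat_sum_cong) (auto simp: acomm_smult_right[of _ D] acomm_a smult_smult_mat)
  also have "\<dots> = (of_bool (d \<and> i = j) * fcoef n s) \<cdot>\<^sub>m 1\<^sub>m D"
    using assms by (simp add: mat_sum_smult interv_sum_list_conv_sum_set_nat)
  finally show ?thesis .
qed

lemma acomm_ahat:
  assumes "i < L" "j < L"
  shows "acomm (ahat N L eps m i) (ahat N L eps n j) = 0\<^sub>m D D"
proof -
  have "acomm (ahat N L eps n j) (ahat N L eps m i)
    = mat_sum D (\<lambda>t. acomm (ahat N L eps n j) (fcoef m t \<cdot>\<^sub>m a t i False)) [0..<N]"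
    by (subst (2) ahat_eq, rule acomm_mat_sum_right) simp_all
  also have "\<dots> = mat_sum D (\<lambda>t. 0 \<cdot>\<^sub>m 1\<^sub>m D) [0..<N]"
    using assms by (intro mat_sum_cong)
      (simp add: acomm_smult_right[of _ D] acomm_commute[of "ahat N L eps n j" D] acomm_a_ahat smult_smult_mat)
  also have "\<dots> = 0\<^sub>m D D" by (simp only: mat_sum_smult one_carrier_mat) (intro eq_matI; simp)
  finally show ?thesis by (simp add: acomm_commute[of "ahat N L eps m i" D])
qed

lemma acomm_dagger_ahat:
  assumes "m < N" "n < N" "i < L" "j < L"
  shows "acomm (dagger (ahat N L eps m i)) (ahat N L eps n j) = of_bool (m = n \<and> i = j) \<cdot>\<^sub>m 1\<^sub>m D"
proof -
  have "acomm (ahat N L eps n j) (dagger (ahat N L eps m i))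
    = mat_sum D (\<lambda>t. acomm (ahat N L eps n j) (cnj (fcoef m t) \<cdot>\<^sub>m a t i True)) [0..<N]"
    unfolding dagger_ahat_eq by (rule acomm_mat_sum_right) simp_all
  also have "\<dots> = mat_sum D (\<lambda>t. (of_bool (i = j) * (cnj (fcoef m t) * fcoef n t)) \<cdot>\<^sub>m 1\<^sub>m D) [0..<N]"
    using assms by (intro mat_sum_cong)
      (simp add: acomm_smult_right[of _ D] acomm_commute[of "ahat N L eps n j" D] acomm_a_ahat smult_smult_mat)
  also have "\<dots> = (of_bool (i = j) * (\<Sum>t<N. cnj (fcoef m t) * fcoef n t)) \<cdot>\<^sub>m 1\<^sub>m D"
    by (simp only: mat_sum_smult one_carrier_mat interv_sum_list_conv_sum_set_nat sum_distrib_left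
        set_upt atLeast0LessThan)
  also have "\<dots> = of_bool (m = n \<and> i = j) \<cdot>\<^sub>m 1\<^sub>m D"
    using assms by (auto simp: fcoef_orthogonal_time)
  finally show ?thesis by (simp add: acomm_commute[of "dagger (ahat N L eps m i)" D])
qed

abbreviation num :: "nat \<Rightarrow> nat \<Rightarrow> complex mat" where
  "num n j \<equiv> dagger (ahat N L eps n j) * ahat N L eps n j"

lemma num_carrier [simp]: "num n j \<in> carrier_mat D D"
  by (rule mult_carrier_mat[of _ D D]) simp_all

lemma Pop_carrier [simp]: "Pop N L eps \<in> carrier_mat D D"
  unfolding Pop_def by (rule mat_sum_carrier) auto

lemma dagger_Pop: "dagger (Pop N L eps) = Pop N L eps"
  unfolding Pop_def
  by (subst dagger_mat_sum) (auto intro!: mat_sum_cong simp: dagger_smult dagger_mult[of _ D D _ D])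

lemma Pop_lowering:
  assumes "n < N" "i < L"
  shows "Pop N L eps * ahat N L eps n i + complex_of_real (omega N eps n) \<cdot>\<^sub>m ahat N L eps n i
    = ahat N L eps n i * Pop N L eps"
proof -
  let ?A = "ahat N L eps n i" and ?w = "\<lambda>m. complex_of_real (omega N eps m)"
    and ?I = "List.product [0..<N] [0..<L]"
  have term_eq: "?A * (?w m \<cdot>\<^sub>m num m k)
      = (?w m \<cdot>\<^sub>m num m k) * ?A + (if (m, k) = (n, i) then ?w n else 0) \<cdot>\<^sub>m ?A"
    if "m < N" "k < L" for m k
  proof -
    have "num m k * ?A + of_bool (m = n \<and> k = i) \<cdot>\<^sub>m ahat N L eps m k = ?A * num m k"
      using assms that by (intro number_operator_lowering[of _ D] acomm_ahat acomm_dagger_ahat) simp_all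
    moreover have "of_bool (m = n \<and> k = i) \<cdot>\<^sub>m ahat N L eps m k = of_bool (m = n \<and> k = i) \<cdot>\<^sub>m ?A"
      by (cases "m = n \<and> k = i") (auto intro!: eq_matI simp: carrier_matD[OF ahat_carrier])
    ultimately have "?A * num m k = num m k * ?A + of_bool (m = n \<and> k = i) \<cdot>\<^sub>m ?A" by simp
    then show ?thesis
      by (auto simp: mult_smult_distrib[of _ D D _ D] mult_smult_assoc_mat[of _ D D _ D]
          add_smult_distrib_left_mat[of _ D D] smult_smult_mat mult_carrier_mat[of _ D D _ D])
  qed
  have "?A * Pop N L eps = mat_sum D (\<lambda>x. ?A * (case x of (m, k) \<Rightarrow> ?w m \<cdot>\<^sub>m num m k)) ?I"
    unfolding Pop_def by (rule mult_mat_sum) auto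
  also have "\<dots> = mat_sum D (\<lambda>x. (case x of (m, k) \<Rightarrow> ?w m \<cdot>\<^sub>m num m k) * ?A
      + (if x = (n, i) then ?w n else 0) \<cdot>\<^sub>m ?A) ?I"
    using term_eq by (intro mat_sum_cong) auto
  also have "\<dots> = mat_sum D (\<lambda>x. (case x of (m, k) \<Rightarrow> ?w m \<cdot>\<^sub>m num m k) * ?A) ?I
      + mat_sum D (\<lambda>x. (if x = (n, i) then ?w n else 0) \<cdot>\<^sub>m ?A) ?I"
    by (rule mat_sum_add) (auto intro!: mult_carrier_mat[of _ D D _ D])
  also have "mat_sum D (\<lambda>x. (case x of (m, k) \<Rightarrow> ?w m \<cdot>\<^sub>m num m k) * ?A) ?I = Pop N L eps * ?A"
    unfolding Pop_def by (rule mat_sum_mult[symmetric]) auto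
  also have "mat_sum D (\<lambda>x. (if x = (n, i) then ?w n else 0) \<cdot>\<^sub>m ?A) ?I
      = (\<Sum>x\<leftarrow>?I. if x = (n, i) then ?w n else 0) \<cdot>\<^sub>m ?A"
    by (rule mat_sum_smult) simp
  also have "(\<Sum>x\<leftarrow>?I. if x = (n, i) then ?w n else 0) = ?w n"
    using assms by (subst sum_list_distinct_conv_sum_set) (auto intro: distinct_product)
  finally show ?thesis by simp
qed

definition shift :: "complex mat" where
  "shift = mexp ((\<i> * complex_of_real eps) \<cdot>\<^sub>m Pop N L eps)"

lemma shift_carrier [simp]: "shift \<in> carrier_mat D D"
  by (simp add: shift_def)

lemma shift_unitary: "shift * dagger shift = 1\<^sub>m D" "dagger shift * shift = 1\<^sub>m D"
  using unitary_mexp[OF Pop_carrier dagger_Pop, of eps] by (simp_all add: shift_def)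

lemma shift_ahat:
  assumes "n < N" "i < L"
  shows "shift * ahat N L eps n i
    = exp (- (\<i> * complex_of_real eps * complex_of_real (omega N eps n))) \<cdot>\<^sub>m ahat N L eps n i * shift"
  unfolding shift_def using mexp_lowering[OF Pop_carrier ahat_carrier Pop_lowering[OF assms], of "\<i> * complex_of_real eps"]
  by (simp add: mult_smult_assoc_mat[of _ D D _ D])

text \<open>Antiperiodic continuation \<open>a\<^sub>N = - a\<^sub>0\<close>, forced by the half-integer frequencies.\<close>

definition abar :: "nat \<Rightarrow> nat \<Rightarrow> bool \<Rightarrow> complex mat" where
  "abar s i d = (if s < N then a s i d else (-1) \<cdot>\<^sub>m a 0 i d)"

lemma abar_carrier [simp]: "abar s i d \<in> carrier_mat D D"
  by (simp add: abar_def)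

lemma dagger_abar: "dagger (abar s i d) = abar s i (\<not> d)"
  by (simp add: abar_def dagger_smult dagger_ladder)

lemma a_eq_sum_ahat:
  assumes "s < N"
  shows "a s i False = mat_sum D (\<lambda>n. cnj (fcoef n s) \<cdot>\<^sub>m ahat N L eps n i) [0..<N]"
proof (rule eq_matI)
  let ?S = "mat_sum D (\<lambda>n. cnj (fcoef n s) \<cdot>\<^sub>m ahat N L eps n i) [0..<N]"
  have S: "?S \<in> carrier_mat D D" by (rule mat_sum_carrier) simp
  show "dim_row (a s i False) = dim_row ?S" "dim_col (a s i False) = dim_col ?S"
    using S ladder_carrier[of "N * L" "s * L + i" False] by (metis carrier_matD)+
  fix c b assume "c < dim_row ?S" "b < dim_col ?S"
  then have cb: "c < D" "b < D" using carrier_matD[OF S] by simp_all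
  have ah: "ahat N L eps n i $$ (c, b) = (\<Sum>t<N. fcoef n t * a t i False $$ (c, b))" for n
    unfolding ahat_eq using cb
    by (subst mat_sum_index)
      (simp_all add: interv_sum_list_conv_sum_set_nat carrier_matD[OF ladder_carrier] atLeast0LessThan)
  have "?S $$ (c, b) = (\<Sum>n<N. cnj (fcoef n s) * ahat N L eps n i $$ (c, b))"
    using cb by (subst mat_sum_index)
      (simp_all add: interv_sum_list_conv_sum_set_nat carrier_matD[OF ahat_carrier] atLeast0LessThan)
  also have "\<dots> = (\<Sum>n<N. \<Sum>t<N. cnj (fcoef n s) * fcoef n t * a t i False $$ (c, b))"
    by (simp add: ah sum_distrib_left mult.assoc)
  also have "\<dots> = (\<Sum>t<N. (\<Sum>n<N. cnj (fcoef n s) * fcoef n t) * a t i False $$ (c, b))"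
    by (subst sum.swap) (simp add: sum_distrib_right)
  also have "\<dots> = (\<Sum>t<N. if t = s then a s i False $$ (c, b) else 0)"
    using assms by (intro sum.cong refl) (auto simp: fcoef_orthogonal_frequency)
  also have "\<dots> = a s i False $$ (c, b)" using assms by simp
  finally show "a s i False $$ (c, b) = ?S $$ (c, b)" by simp
qed

lemma abar_eq_sum_ahat:
  assumes "s \<le> N"
  shows "abar s i False = mat_sum D (\<lambda>n. cnj (fcoef n s) \<cdot>\<^sub>m ahat N L eps n i) [0..<N]"
proof (cases "s < N")
  case True
  then show ?thesis by (simp add: abar_def a_eq_sum_ahat)
next
  case False
  then have s: "s = N" using assms by simp
  have "abar s i False = (-1) \<cdot>\<^sub>m 1\<^sub>m D * a 0 i False"
    using False by (simp add: abar_def mult_smult_assoc_mat[of _ D D _ D] left_mult_one_mat[OF ladder_carrier])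
  also have "\<dots> = mat_sum D (\<lambda>n. (-1) \<cdot>\<^sub>m 1\<^sub>m D * (cnj (fcoef n 0) \<cdot>\<^sub>m ahat N L eps n i)) [0..<N]"
    using N by (subst a_eq_sum_ahat) (auto intro!: mult_mat_sum)
  also have "\<dots> = mat_sum D (\<lambda>n. cnj (fcoef n s) \<cdot>\<^sub>m ahat N L eps n i) [0..<N]"
    by (intro mat_sum_cong) (simp add: s fcoef_N mult_smult_assoc_mat[of _ D D _ D] smult_smult_mat
        left_mult_one_mat[of _ D D])
  finally show ?thesis .
qed

lemma shift_a:
  assumes s: "s < N" and i: "i < L"
  shows "shift * a s i d = abar (Suc s) i d * shift"
proof -
  have "shift * abar s i False = mat_sum D (\<lambda>n. shift * (cnj (fcoef n s) \<cdot>\<^sub>m ahat N L eps n i)) [0..<N]"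
    using s by (simp only: abar_eq_sum_ahat less_imp_le) (rule mult_mat_sum; simp)
  also have "\<dots> = mat_sum D (\<lambda>n. cnj (fcoef n (Suc s)) \<cdot>\<^sub>m ahat N L eps n i * shift) [0..<N]"
    using i by (intro mat_sum_cong)
      (simp add: mult_smult_distrib[of _ D D _ D] mult_smult_assoc_mat[of _ D D _ D] shift_ahat
        smult_smult_mat cnj_fcoef_Suc mult.commute[of "exp _"])
  also have "\<dots> = abar (Suc s) i False * shift"
    using s by (simp only: abar_eq_sum_ahat Suc_leI) (rule mat_sum_mult[symmetric]; simp)
  finally have False_case: "shift * a s i False = abar (Suc s) i False * shift"
    using s by (simp add: abar_def)
  from unitary_dagger_intertwine[OF shift_carrier ladder_carrier abar_carrier shift_unitary this]
  have "shift * a s i True = abar (Suc s) i True * shift"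
    by (simp add: dagger_ladder dagger_abar)
  with False_case show ?thesis by (cases d) auto
qed

lemma ham_slice_carrier [simp]: "ham_slice N L p t \<in> carrier_mat D D"
  unfolding ham_slice_def by (rule eval_poly_carrier) simp

lemma shift_ham_slice:
  assumes p: "\<forall>(c, w) \<in> set p. even (length w) \<and> (\<forall>(i, d) \<in> set w. i < L)" and s: "s < N"
  shows "shift * ham_slice N L p s = ham_slice N L p (Suc s mod N) * shift"
proof -
  have "shift * ham_slice N L p s = eval_poly D (abar (Suc s)) p * shift"
    unfolding ham_slice_def using p s
    by (intro eval_poly_intertwine[where L = L]) (auto simp: shift_a)
  moreover have "eval_poly D (abar (Suc s)) p = ham_slice N L p (Suc s mod N)"
  proof (cases "Suc s < N")
    case True
    then show ?thesis by (simp add: ham_slice_def abar_def[abs_def])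
  next
    case False
    with s have "Suc s = N" by simp
    then show ?thesis using eval_poly_uminus[of "a 0" D p] p
      by (auto simp: ham_slice_def abar_def[abs_def])
  qed
  ultimately show ?thesis by simp
qed

lemma a_anticommute:
  assumes "s < N" "t < N" "s \<noteq> t" "i < L" "j < L"
  shows "a s i d * a t j e = (-1) \<cdot>\<^sub>m a t j e * a s i d"
proof -
  let ?X = "a s i d * a t j e" and ?Y = "a t j e * a s i d"
  have c: "?X \<in> carrier_mat D D" "?Y \<in> carrier_mat D D" by (rule mult_carrier_mat[of _ D D]; simp)+
  have z: "?X + ?Y = 0 \<cdot>\<^sub>m 1\<^sub>m D"
    using acomm_a[OF assms(1,2,4,5), of d e] assms(3) by (simp add: acomm_def)
  have "?X = (-1) \<cdot>\<^sub>m ?Y"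
  proof (rule eq_matI)
    fix k l assume "k < dim_row ((-1) \<cdot>\<^sub>m ?Y)" "l < dim_col ((-1) \<cdot>\<^sub>m ?Y)"
    then have kl: "k < D" "l < D" by (simp_all add: carrier_matD[OF ladder_carrier])
    have "(?X + ?Y) $$ (k, l) = ?X $$ (k, l) + ?Y $$ (k, l)"
      using kl carrier_matD[OF c(2)] by (intro index_add_mat) simp_all
    then have "?X $$ (k, l) + ?Y $$ (k, l) = 0" using z kl by simp
    moreover have "((-1) \<cdot>\<^sub>m ?Y) $$ (k, l) = - ?Y $$ (k, l)"
      using kl carrier_matD[OF c(2)] by (subst index_smult_mat) simp_all
    ultimately show "?X $$ (k, l) = ((-1) \<cdot>\<^sub>m ?Y) $$ (k, l)" by (metis eq_neg_iff_add_eq_0)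
  qed (simp_all add: carrier_matD[OF ladder_carrier])
  then show ?thesis by (simp add: mult_smult_assoc_mat[of _ D D _ D])
qed

lemma ham_slice_commute:
  assumes p: "\<forall>(c, w) \<in> set p. even (length w) \<and> (\<forall>(i, d) \<in> set w. i < L)"
    and st: "s < N" "t < N"
  shows "ham_slice N L p s * ham_slice N L p t = ham_slice N L p t * ham_slice N L p s"
proof (cases "s = t")
  case False
  have letter: "ham_slice N L p s * a t j e = a t j e * ham_slice N L p s" if j: "j < L" for j e
  proof -
    have "a t j e * ham_slice N L p s = eval_poly D (\<lambda>i d. (-1) \<cdot>\<^sub>m a s i d) p * a t j e"
      unfolding ham_slice_def using p st False j
      by (intro eval_poly_intertwine[where L = L]) (auto intro!: a_anticommute)
    also have "eval_poly D (\<lambda>i d. (-1) \<cdot>\<^sub>m a s i d) p = ham_slice N L p s"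
      unfolding ham_slice_def using p by (intro eval_poly_uminus) auto
    finally show ?thesis by simp
  qed
  show ?thesis
    using p letter unfolding ham_slice_def[of N L p t]
    by (intro eval_poly_intertwine[where L = L]) auto
qed simp

end

subsection \<open>Ordered products\<close>

lemma oprod_carrier:
  "(\<And>t. t < n \<Longrightarrow> F t \<in> carrier_mat D D) \<Longrightarrow> oprod D n F \<in> carrier_mat D D"
  unfolding oprod_def by (rule foldr_mult_carrier) simp

lemma oprod_cong: "(\<And>t. t < n \<Longrightarrow> F t = G t) \<Longrightarrow> oprod D n F = oprod D n G"
  unfolding oprod_def by (intro arg_cong2[of _ _ _ _ "foldr (*)"] map_cong) auto

lemma oprod_intertwine:
  assumes "X \<in> carrier_mat D D"
    and "\<And>t. t < n \<Longrightarrow> F t \<in> carrier_mat D D" "\<And>t. t < n \<Longrightarrow> G t \<in> carrier_mat D D"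
    and "\<And>t. t < n \<Longrightarrow> X * F t = G t * X"
  shows "X * oprod D n F = oprod D n G * X"
  unfolding oprod_def using assms by (intro foldr_mult_intertwine) auto

lemma oprod_Suc_left: "oprod D (Suc n) F = F 0 * oprod D n (\<lambda>t. F (Suc t))"
  by (simp add: oprod_def map_upt_Suc del: upt_Suc)

lemma oprod_Suc_right:
  assumes "\<And>t. t \<le> n \<Longrightarrow> F t \<in> carrier_mat D D"
  shows "oprod D (Suc n) F = oprod D n F * F n"
  using assms
proof (induction n arbitrary: F)
  case 0
  then have "F 0 \<in> carrier_mat D D" by simp
  then show ?case using left_mult_one_mat[of "F 0" D D] right_mult_one_mat[of "F 0" D D]
    by (simp add: oprod_def)
next
  case (Suc n)
  have c: "F 0 \<in> carrier_mat D D" "oprod D n (\<lambda>t. F (Suc t)) \<in> carrier_mat D D" "F (Suc n) \<in> carrier_mat D D"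
    using Suc.prems by (auto intro!: oprod_carrier)
  have "oprod D (Suc (Suc n)) F = F 0 * (oprod D n (\<lambda>t. F (Suc t)) * F (Suc n))"
    using Suc.IH[of "\<lambda>t. F (Suc t)"] Suc.prems by (simp add: oprod_Suc_left[of D "Suc n"])
  also have "\<dots> = oprod D (Suc n) F * F (Suc n)"
    using assoc_mult_mat[OF c] by (simp add: oprod_Suc_left)
  finally show ?case .
qed

lemma dagger_oprod:
  assumes "\<And>t. t < n \<Longrightarrow> F t \<in> carrier_mat D D"
    and "\<And>s t. s < n \<Longrightarrow> t < n \<Longrightarrow> F s * F t = F t * F s"
  shows "dagger (oprod D n F) = oprod D n (\<lambda>t. dagger (F t))"
  using assms
proof (induction n)
  case 0
  show ?case by (simp add: oprod_def)
next
  case (Suc n)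
  have o: "oprod D n F \<in> carrier_mat D D" using Suc.prems by (intro oprod_carrier) auto
  have comm: "dagger (F n) * dagger (F t) = dagger (F t) * dagger (F n)" if "t < n" for t
    using Suc.prems(2)[of t n] Suc.prems(1)[of t] Suc.prems(1)[of n] that
    by (metis dagger_mult less_SucI lessI)
  have "dagger (oprod D (Suc n) F) = dagger (F n) * dagger (oprod D n F)"
    using oprod_Suc_right[of n F D] Suc.prems o dagger_mult[of _ D D _ D] by simp
  also have "\<dots> = dagger (F n) * oprod D n (\<lambda>t. dagger (F t))" using Suc by simp
  also have "\<dots> = oprod D n (\<lambda>t. dagger (F t)) * dagger (F n)"
    using Suc.prems comm by (intro oprod_intertwine) auto
  also have "\<dots> = oprod D (Suc n) (\<lambda>t. dagger (F t))"
    using Suc.prems by (intro oprod_Suc_right[symmetric]) auto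
  finally show ?case .
qed

lemma oprod_mult_oprod:
  assumes "\<And>t. t < n \<Longrightarrow> F t \<in> carrier_mat D D" "\<And>t. t < n \<Longrightarrow> G t \<in> carrier_mat D D"
    and "\<And>s t. s < n \<Longrightarrow> t < n \<Longrightarrow> F s * G t = G t * F s"
  shows "oprod D n F * oprod D n G = oprod D n (\<lambda>t. F t * G t)"
  using assms
proof (induction n)
  case 0
  show ?case by (simp add: oprod_def)
next
  case (Suc n)
  have c: "oprod D n F \<in> carrier_mat D D" "oprod D n G \<in> carrier_mat D D"
    "F n \<in> carrier_mat D D" "G n \<in> carrier_mat D D"
    using Suc.prems by (auto intro!: oprod_carrier)
  have swap: "F n * oprod D n G = oprod D n G * F n"
    using Suc.prems by (intro oprod_intertwine) auto
  note assoc = assoc_mult_mat[of _ D D _ D _ D]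
  note [simp] = c mult_carrier_mat[of _ D D _ D]
  have "oprod D (Suc n) F * oprod D (Suc n) G = oprod D n F * F n * (oprod D n G * G n)"
    using Suc.prems by (simp add: oprod_Suc_right)
  also have "\<dots> = oprod D n F * ((F n * oprod D n G) * G n)" by (simp add: assoc)
  also have "\<dots> = oprod D n F * oprod D n G * (F n * G n)" unfolding swap by (simp add: assoc)
  also have "\<dots> = oprod D (Suc n) (\<lambda>t. F t * G t)"
    using Suc by (subst oprod_Suc_right) auto
  finally show ?case .
qed

lemma oprod_rotate:
  assumes n: "N = Suc n" and K: "\<And>s t. s < N \<Longrightarrow> K s t \<in> carrier_mat D D"
    and comm: "\<And>s t s' t'. s < N \<Longrightarrow> s' < N \<Longrightarrow> K s t * K s' t' = K s' t' * K s t"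
  shows "oprod D N (\<lambda>t. K (Suc t mod N) t) = K 0 n * oprod D n (\<lambda>t. K (Suc t) t)"
proof -
  have "oprod D N (\<lambda>t. K (Suc t mod N) t) = oprod D n (\<lambda>t. K (Suc t mod N) t) * K 0 n"
    using K unfolding n by (subst oprod_Suc_right) auto
  also have "oprod D n (\<lambda>t. K (Suc t mod N) t) = oprod D n (\<lambda>t. K (Suc t) t)"
    by (rule oprod_cong) (simp add: n)
  also have "\<dots> * K 0 n = K 0 n * oprod D n (\<lambda>t. K (Suc t) t)"
    using K comm n by (intro oprod_intertwine[symmetric]) auto
  finally show ?thesis .
qed

subsection \<open>Hermiticity of the slice Hamiltonians\<close>

lemma bit_mult_exp_add:
  assumes "b < (2 ^ L :: nat)"
  shows "bit (q * 2 ^ L + b) k = (if k < L then bit b k else bit q (k - L))"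
proof (cases "k < L")
  case True
  have "take_bit L (q * 2 ^ L + b) = b" using assms by (simp add: take_bit_eq_mod)
  then show ?thesis using True by (metis bit_take_bit_iff)
next
  case False
  have "drop_bit L (q * 2 ^ L + b) = q" using assms by (simp add: drop_bit_eq_div)
  then have "bit q (k - L) = bit (q * 2 ^ L + b) (L + (k - L))" by (metis bit_drop_bit_eq comp_apply)
  then show ?thesis using False by simp
qed

lemma flip_bit_mult_exp_add:
  assumes "b < (2 ^ L :: nat)" "i < L"
  shows "flip_bit i (q * 2 ^ L + b) = q * 2 ^ L + flip_bit i b"
  using assms by (intro bit_eqI) (auto simp: bit_flip_bit_iff bit_mult_exp_add flip_bit_less_exp)

lemma jw_sign_mult_exp_add:
  assumes "b < (2 ^ L :: nat)" "i < L"
  shows "jw_sign i (q * 2 ^ L + b) = jw_sign i b"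
proof -
  have "{k. k < i \<and> bit (q * 2 ^ L + b) k} = {k. k < i \<and> bit b k}"
    using assms by (auto simp: bit_mult_exp_add)
  then show ?thesis by (simp add: jw_sign_def)
qed

text \<open>Isometry of the \<open>L\<close>-mode space onto the block of \<open>M\<close>-mode states whose modes \<open>\<ge> L\<close> are occupied
  according to the binary digits of \<open>q\<close>. The first \<open>L\<close> modes carry no Jordan-Wigner sign from the
  others, so these blocks reduce them.\<close>

definition block :: "nat \<Rightarrow> nat \<Rightarrow> nat \<Rightarrow> complex mat" where
  "block M L q = mat (fock_dim M) (fock_dim L) (\<lambda>(c, k). of_bool (c = q * fock_dim L + k))"

lemma block_carrier [simp]: "block M L q \<in> carrier_mat (fock_dim M) (fock_dim L)"
  by (simp add: block_def)

lemma block_index_less: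
  assumes "L \<le> M" "q < 2 ^ (M - L)" "b < fock_dim L"
  shows "q * fock_dim L + b < fock_dim M"
proof -
  have "q * fock_dim L + b < Suc q * fock_dim L" using assms by simp
  also have "\<dots> \<le> 2 ^ (M - L) * fock_dim L" using assms by (intro mult_le_mono1) simp
  also have "\<dots> = fock_dim M" using assms by (simp add: fock_dim_def flip: power_add)
  finally show ?thesis .
qed

lemma mult_block_index:
  assumes A: "A \<in> carrier_mat (fock_dim M) (fock_dim M)" and c: "c < fock_dim M"
    and b: "b < fock_dim L" and q: "q * fock_dim L + b < fock_dim M"
  shows "(A * block M L q) $$ (c, b) = A $$ (c, q * fock_dim L + b)"
proof -
  have "(A * block M L q) $$ (c, b) = (\<Sum>l<fock_dim M. A $$ (c, l) * block M L q $$ (l, b))"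
    by (rule index_mult_mat_sum[OF A block_carrier c b])
  also have "\<dots> = (\<Sum>l<fock_dim M. if l = q * fock_dim L + b then A $$ (c, l) else 0)"
    using b by (intro sum.cong) (auto simp: block_def)
  finally show ?thesis using q by simp
qed

lemma block_ladder:
  assumes "L \<le> M" "q < 2 ^ (M - L)" "i < L"
  shows "block M L q * ladder L i d = ladder M i d * block M L q"
proof (rule eq_matI)
  fix c b assume "c < dim_row (ladder M i d * block M L q)" "b < dim_col (ladder M i d * block M L q)"
  then have c: "c < fock_dim M" and b: "b < fock_dim L"
    by (simp_all add: carrier_matD[OF ladder_carrier] block_def)
  have q: "q * fock_dim L + b < fock_dim M" using block_index_less assms b by simp
  have f: "flip_bit i b < fock_dim L" using b assms flip_bit_less_exp by (simp add: fock_dim_def)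
  have "(block M L q * ladder L i d) $$ (c, b)
    = (if bit b i \<noteq> d then jw_sign i b * of_bool (c = q * fock_dim L + flip_bit i b) else 0)"
    using assms c b f by (subst mult_ladder_index[OF block_carrier]) (auto simp: block_def)
  also have "\<dots> = ladder M i d $$ (c, q * fock_dim L + b)"
    using assms b unfolding ladder_index[OF c q]
    by (simp add: fock_dim_def bit_mult_exp_add flip_bit_mult_exp_add jw_sign_mult_exp_add)
  also have "\<dots> = (ladder M i d * block M L q) $$ (c, b)"
    by (rule mult_block_index[OF ladder_carrier c b q, symmetric])
  finally show "(block M L q * ladder L i d) $$ (c, b) = (ladder M i d * block M L q) $$ (c, b)" .
qed (simp_all add: carrier_matD[OF ladder_carrier] block_def)

lemma ham_h_carrier [simp]: "ham_h L p \<in> carrier_mat (fock_dim L) (fock_dim L)"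
  unfolding ham_h_def by (rule eval_poly_carrier) simp

context time_lattice
begin

lemma ham_slice_0_index:
  assumes p: "\<forall>(c, w) \<in> set p. \<forall>(i, d) \<in> set w. i < L" and c: "c < D" and b: "b < D"
  shows "ham_slice N L p 0 $$ (c, b) = (if c div fock_dim L = b div fock_dim L
    then ham_h L p $$ (c mod fock_dim L, b mod fock_dim L) else 0)"
proof -
  let ?d = "fock_dim L"
  define q where "q = b div ?d"
  have d: "?d > 0" by (simp add: fock_dim_def)
  have le: "L \<le> N * L" using N by simp
  have "D = 2 ^ (N * L - L) * ?d" using le by (simp add: fock_dim_def flip: power_add)
  then have q: "q < 2 ^ (N * L - L)" using b d by (simp add: q_def less_mult_imp_div_less)
  have split_index: "c = q * ?d + k \<longleftrightarrow> k = c mod ?d \<and> c div ?d = q" if "k < ?d" for k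
    using that by auto
  have b': "b mod ?d < ?d" and bq: "q * ?d + b mod ?d = b" using d by (simp_all add: q_def)
  have "block (N * L) L q * ham_h L p = ham_slice N L p 0 * block (N * L) L q"
    unfolding ham_h_def ham_slice_def using p le q
    by (intro eval_poly_intertwine[where L = L]) (auto simp: block_ladder)
  moreover have "(ham_slice N L p 0 * block (N * L) L q) $$ (c, b mod ?d) = ham_slice N L p 0 $$ (c, b)"
    using mult_block_index[OF ham_slice_carrier c b', of q p 0] bq b by simp
  moreover have "(block (N * L) L q * ham_h L p) $$ (c, b mod ?d)
      = (\<Sum>k<?d. block (N * L) L q $$ (c, k) * ham_h L p $$ (k, b mod ?d))"
    by (rule index_mult_mat_sum[OF block_carrier ham_h_carrier c b'])
  moreover have "\<dots> = (\<Sum>k<?d. if k = c mod ?d then if c div ?d = q then ham_h L p $$ (c mod ?d, b mod ?d) else 0 else 0)"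
    using c by (intro sum.cong) (auto simp: block_def split_index)
  ultimately show ?thesis using d by (simp add: q_def)
qed

lemma dagger_ham_slice_0:
  assumes p: "valid_ham L p"
  shows "dagger (ham_slice N L p 0) = ham_slice N L p 0"
proof (rule eq_matI)
  have p': "\<forall>(c, w) \<in> set p. \<forall>(i, d) \<in> set w. i < L" using p by (auto simp: valid_ham_def)
  have herm: "cnj (ham_h L p $$ (l, k)) = ham_h L p $$ (k, l)" if "k < fock_dim L" "l < fock_dim L" for k l
    using p dagger_index[of "ham_h L p", OF ham_h_carrier that] by (simp add: valid_ham_def)
  have d: "fock_dim L > 0" by (simp add: fock_dim_def)
  fix c b assume "c < dim_row (ham_slice N L p 0)" "b < dim_col (ham_slice N L p 0)"
  then have "c < D" "b < D" by (simp_all add: carrier_matD[OF ham_slice_carrier])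
  then show "dagger (ham_slice N L p 0) $$ (c, b) = ham_slice N L p 0 $$ (c, b)"
    using d by (simp add: dagger_index[OF ham_slice_carrier] ham_slice_0_index[OF p'] herm)
qed (simp_all add: dagger_def carrier_matD[OF ham_slice_carrier])

end

subsection \<open>Evolution on the slices\<close>

locale sliced_hamiltonian = time_lattice +
  fixes p :: ladder_poly
  assumes valid: "valid_ham L p"
begin

lemma even_word: "\<forall>(c, w) \<in> set p. even (length w) \<and> (\<forall>(i, d) \<in> set w. i < L)"
  using valid by (simp add: valid_ham_def)

lemma dagger_ham_slice: "t < N \<Longrightarrow> dagger (ham_slice N L p t) = ham_slice N L p t"
proof (induction t)
  case 0
  show ?case by (rule dagger_ham_slice_0[OF valid])
next
  case (Suc t)
  let ?H = "ham_slice N L p"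
  note [simp] = mult_carrier_mat[of _ D D _ D] dagger_carrier[of _ D D]
  note assoc = assoc_mult_mat[of _ D D _ D _ D]
  have sh: "shift * ?H t = ?H (Suc t) * shift"
    using shift_ham_slice[OF even_word, of t] Suc.prems by simp
  have "shift * ?H t = dagger (?H (Suc t)) * shift"
    using unitary_dagger_intertwine[OF shift_carrier _ _ shift_unitary sh] Suc by simp
  with sh have "dagger (?H (Suc t)) * shift * dagger shift = ?H (Suc t) * shift * dagger shift" by simp
  then show ?case by (simp add: assoc shift_unitary right_mult_one_mat[of _ D])
qed

definition evol :: "nat \<Rightarrow> real \<Rightarrow> complex mat" where
  "evol t r = mexp ((\<i> * complex_of_real r) \<cdot>\<^sub>m ham_slice N L p t)"

lemma evol_carrier [simp]: "evol t r \<in> carrier_mat D D"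
  by (simp add: evol_def)

lemma evol_add: "evol t r * evol t r' = evol t (r + r')"
  by (simp add: evol_def mexp_smult_add[of _ D] distrib_left)

lemma dagger_evol: "t < N \<Longrightarrow> dagger (evol t r) = evol t (- r)"
  using unitary_mexp(1)[OF ham_slice_carrier dagger_ham_slice] by (simp add: evol_def)

lemma evol_commute:
  assumes "s < N" "t < N"
  shows "evol s r * evol t r' = evol t r' * evol s r"
proof -
  have "ham_slice N L p t * evol s r = evol s r * ham_slice N L p t"
    unfolding evol_def using ham_slice_commute[OF even_word] assms
    by (intro mexp_smult_intertwine[of _ D _ D]) simp_all
  then show ?thesis
    unfolding evol_def[of t] by (intro mexp_smult_intertwine[of _ D _ D]) simp_all
qed

lemma shift_evol: "t < N \<Longrightarrow> shift * evol t r = evol (Suc t mod N) r * shift"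
  unfolding evol_def using shift_ham_slice[OF even_word]
  by (intro mexp_smult_intertwine[of _ D _ D]) simp_all

lemma shift_oprod_evol:
  assumes Suc: "N = Suc n"
  shows "shift * oprod D N (\<lambda>t. evol t (r t)) = evol 0 (r n) * oprod D n (\<lambda>t. evol (Suc t) (r t)) * shift"
proof -
  have "shift * oprod D N (\<lambda>t. evol t (r t)) = oprod D N (\<lambda>t. evol (Suc t mod N) (r t)) * shift"
    by (intro oprod_intertwine) (simp_all add: shift_evol)
  also have "oprod D N (\<lambda>t. evol (Suc t mod N) (r t)) = evol 0 (r n) * oprod D n (\<lambda>t. evol (Suc t) (r t))"
    by (rule oprod_rotate[OF Suc]) (simp_all add: evol_commute)
  finally show ?thesis .
qed

lemma shift_factorization:
  "shift * oprod D N (\<lambda>t. evol t (- eps))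
    = evol 0 (- (eps * real N)) * dagger (oprod D N (\<lambda>t. evol t (eps * real t))) * shift
      * oprod D N (\<lambda>t. evol t (eps * real t))"
proof -
  obtain n where n: "N = Suc n" using N by (cases N) auto
  have less: "0 < N" "t < n \<Longrightarrow> Suc t < N" for t using n by simp_all
  define V where "V = oprod D N (\<lambda>t. evol t (eps * real t))"
  define W where "W = oprod D n (\<lambda>t. evol (Suc t) (eps * real t))"
  define W' where "W' = oprod D n (\<lambda>t. evol (Suc t) (- (eps * real (Suc t))))"
  define R where "R = oprod D n (\<lambda>t. evol (Suc t) (- eps))"
  have [simp]: "V \<in> carrier_mat D D" "W \<in> carrier_mat D D" "W' \<in> carrier_mat D D" "R \<in> carrier_mat D D"
    unfolding V_def W_def W'_def R_def by (auto intro!: oprod_carrier)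
  note [simp] = mult_carrier_mat[of _ D D _ D] dagger_carrier[of _ D D]
  note assoc = assoc_mult_mat[of _ D D _ D _ D]
  have "dagger V = oprod D N (\<lambda>t. dagger (evol t (eps * real t)))"
    unfolding V_def by (rule dagger_oprod) (simp_all add: evol_commute)
  also have "\<dots> = oprod D N (\<lambda>t. evol t (- (eps * real t)))"
    by (rule oprod_cong) (simp add: dagger_evol)
  also have "\<dots> = evol 0 0 * W'" unfolding W'_def by (subst n, subst oprod_Suc_left) simp
  finally have dV: "dagger V = evol 0 0 * W'" .
  have WW: "W' * W = R"
    unfolding W_def W'_def R_def
    by (subst oprod_mult_oprod) (auto intro!: oprod_cong simp: less evol_commute evol_add distrib_left)
  have W'0: "W' * evol 0 r = evol 0 r * W'" for r
    unfolding W'_def by (intro oprod_intertwine[symmetric]) (auto simp: less evol_commute)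
  have "shift * V = evol 0 (eps * real n) * W * shift"
    unfolding V_def W_def by (rule shift_oprod_evol[OF n])
  then have "evol 0 (- (eps * real N)) * dagger V * shift * V
      = evol 0 (- (eps * real N)) * (evol 0 0 * ((W' * evol 0 (eps * real n)) * (W * shift)))"
    by (simp add: dV assoc)
  also have "\<dots> = (evol 0 (- (eps * real N)) * evol 0 0) * evol 0 (eps * real n) * (W' * W) * shift"
    unfolding W'0 by (simp add: assoc)
  also have "\<dots> = evol 0 (- eps) * R * shift"
    unfolding WW evol_add by (simp add: n algebra_simps)
  also have "\<dots> = shift * oprod D N (\<lambda>t. evol t (- eps))"
    unfolding R_def by (rule shift_oprod_evol[OF n, symmetric])
  finally show ?thesis by (simp add: V_def)
qed

end

theorem theorem3:
  fixes L N :: nat and eps :: real and p :: ladder_poly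
  assumes "L \<ge> 1" and "N \<ge> 1" and "eps > 0"
    and "valid_ham L p"
  shows "(let D = fock_dim (N*L); T = eps * real N;
              H = ham_slice N L p;
              P = Pop N L eps;
              V = oprod D N (\<lambda>t. mexp ((\<i> * complex_of_real (eps * real t)) \<cdot>\<^sub>m H t))
          in mexp ((\<i> * complex_of_real eps) \<cdot>\<^sub>m P)
               * oprod D N (\<lambda>t. mexp ((- \<i> * complex_of_real eps) \<cdot>\<^sub>m H t))
             = mexp ((- \<i> * complex_of_real T) \<cdot>\<^sub>m H 0) * dagger V
               * mexp ((\<i> * complex_of_real eps) \<cdot>\<^sub>m P) * V)"
proof -
  interpret sliced_hamiltonian N L eps p
    using assms by unfold_locales
  show ?thesis
    using shift_factorization by (simp add: Let_def shift_def evol_def)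
qed

end
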